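(* There is an effectively simple set $A$ which does not have hard instances, i.e., for every constant $c$ there are only finitely many $x$ with $ic(x:A) \geq C(x) - c$. In particular, there is a T-complete (Turing-complete r.e.) set which does not have hard instances.
   Context: $\mathbb{N}$ is identified with $\{0,1\}^*$ via the canonical (length-lexicographic) bijection, so sets may be viewed as subsets of either. $\{W_e\}_{e\in\mathbb{N}}$ is the standard enumeration of all r.e. sets, and $\overline{A}$ is the complement of $A$. A set $A$ is effectively simple if it is a coinfinite r.e. set and there is a total recursive function $f$ such that for all $e$: if $W_e \subseteq \overline{A}$ then $|W_e| \leq f(e)$. A set is T-complete if it is r.e. and every r.e. set is Turing reducible to it. $\lambda$ is the empty string, $l(p)$ is the length of $p \in \{0,1\}^*$, $\chi_A$ is the characteristic function of $A$, and $\perp$ is a special symbol ("don't know"). A (possibly partial) function $g : \{0,1\}^* \to \{0,1,\perp\}$ is $A$-consistent if for all $x \in \mathrm{dom}(g)$, $g(x) = \chi_A(x)$ or $g(x) = \perp$. For a partial recursive mapping $V : \{0,1\}^* \times \{0,1\}^* \to \{0,1\}^* \cup \{\perp\}$, $x \in \{0,1\}^*$ and $A \subseteq \{0,1\}^*$, define - $C_V(x) = \min\{ l(p) : V(p,\lambda) = x\}$ (Kolmogorov complexity); - $ic_V(x:A) = \min\{ l(p) : z \mapsto V(p,z)$ is a total $A$-consistent function and $V(p,x) = \chi_A(x)\}$ (instance complexity); with value $\infty$ if no such $p$ exists. (The output values $0,1$ of $V$ are regarded as the one-letter strings $0,1$.) Fix an optimal partial recursive mapping $U : \{0,1\}^*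 \times \{0,1\}^* \to \{0,1\}^* \cup \{\perp\}$, i.e., one such that for every partial recursive mapping $V : \{0,1\}^* \times \{0,1\}^* \to \{0,1\}^* \cup \{\perp\}$ there is a constant $d$ with $C_U(x) \leq C_V(x) + d$ and $ic_U(x:A) \leq ic_V(x:A) + d$ for all $x, A$. Write $C(x) = C_U(x)$ and $ic(x:A) = ic_U(x:A)$. A set $A$ has hard instances if there is a constant $c$ such that $ic(x:A) \geq C(x) - c$ for infinitely many $x$. *)

theory Defs
  imports "HOL-Library.Nat_Bijection" "HOL-Library.Extended_Nat"
begin

section \<open>Recursive functions relative to an oracle\<close>

text \<open>
  Programs for the partial recursive functions from \<open>nat\<close> to \<open>nat\<close>, with several arguments packed
  into one by Cantor pairing (\<open>prod_encode\<close>).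
\<close>

datatype prog =
    Zero
  | Successor
  | First
  | Second
  | Oracle
  | Tuple prog prog
  | Compose prog prog
  | PrimRec prog prog
  | Minimise prog

text \<open>
  \<open>eval X c\<close> is the partial function computed by \<open>c\<close> with oracle \<open>X\<close>; \<open>None\<close> means divergence.
  In the clause for \<open>Minimise\<close>, the search reaches \<open>m\<close> only if \<open>f\<close> converges to a nonzero value at all
  smaller numbers.
\<close>

primrec eval :: "nat set \<Rightarrow> prog \<Rightarrow> (nat \<rightharpoonup> nat)" where
  "eval X Zero = (\<lambda>n. Some 0)"
| "eval X Successor = (\<lambda>n. Some (Suc n))"
| "eval X First = (\<lambda>n. Some (fst (prod_decode n)))"
| "eval X Second = (\<lambda>n. Some (snd (prod_decode n)))"
| "eval X Oracle = (\<lambda>n. Some (if n \<in> X then 1 else 0))"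
| "eval X (Tuple f g) = (\<lambda>n.
     Option.bind (eval X f n) (\<lambda>a. Option.bind (eval X g n) (\<lambda>b. Some (prod_encode (a, b)))))"
| "eval X (Compose f g) = (\<lambda>n. Option.bind (eval X g n) (eval X f))"
| "eval X (PrimRec f g) = (\<lambda>n. case prod_decode n of (a, m) \<Rightarrow>
     rec_nat (eval X f a)
       (\<lambda>k r. Option.bind r (\<lambda>v. eval X g (prod_encode (a, prod_encode (k, v))))) m)"
| "eval X (Minimise f) = (\<lambda>n.
     if \<exists>m. eval X f (prod_encode (n, m)) = Some 0
            \<and> (\<forall>k<m. \<exists>v>0. eval X f (prod_encode (n, k)) = Some v)
     then Some (LEAST m. eval X f (prod_encode (n, m)) = Some 0)
     else None)"

definition partial_recursive :: "(nat \<rightharpoonup> nat) \<Rightarrow> bool" where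
  "partial_recursive f \<longleftrightarrow> (\<exists>c. eval {} c = f)"

definition total_recursive :: "(nat \<Rightarrow> nat) \<Rightarrow> bool" where
  "total_recursive f \<longleftrightarrow> partial_recursive (\<lambda>n. Some (f n))"

definition turing_reducible :: "nat set \<Rightarrow> nat set \<Rightarrow> bool" where
  "turing_reducible A B \<longleftrightarrow> (\<exists>c. \<forall>n. eval B c n = Some (if n \<in> A then 1 else 0))"


section \<open>The standard enumeration of the r.e.\ sets\<close>

primrec encode :: "prog \<Rightarrow> nat" where
  "encode Zero = 0"
| "encode Successor = 1"
| "encode First = 2"
| "encode Second = 3"
| "encode Oracle = 4"
| "encode (Tuple f g) = 5 + 4 * prod_encode (encode f, encode g)"
| "encode (Compose f g) = 6 + 4 * prod_encode (encode f, encode g)"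
| "encode (PrimRec f g) = 7 + 4 * prod_encode (encode f, encode g)"
| "encode (Minimise f) = 8 + 4 * encode f"

lemma inj_encode: "inj encode"
proof (rule injI)
  fix c d show "encode c = encode d \<Longrightarrow> c = d"
  proof (induction c arbitrary: d)
    case Zero then show ?case by (cases d) auto
  next
    case Successor then show ?case by (cases d) auto
  next
    case First then show ?case by (cases d) auto
  next
    case Second then show ?case by (cases d) auto
  next
    case Oracle then show ?case by (cases d) auto
  next
    case (Tuple f g) then show ?case by (cases d) (auto, presburger+)
  next
    case (Compose f g) then show ?case by (cases d) (auto, presburger+)
  next
    case (PrimRec f g) then show ?case by (cases d) (auto, presburger+)
  next
    case (Minimise f) then show ?case by (cases d) (auto, presburger+)
  qed
qed

lemma surj_encode: "surj encode"
proof -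
  have "\<exists>c. encode c = n" for n
  proof (induction n rule: less_induct)
    case (less n)
    show ?case
    proof (cases "n < 5")
      case True
      then consider "n = 0" | "n = 1" | "n = 2" | "n = 3" | "n = 4" by linarith
      then show ?thesis by cases (metis encode.simps)+
    next
      case False
      define q where "q = (n - 5) div 4"
      obtain a b where ab: "q = prod_encode (a, b)"
        by (metis prod_decode_inverse surj_pair)
      have q: "q < n" using False by (simp add: q_def) 
      have "a \<le> q" "b \<le> q" by (simp_all add: ab le_prod_encode_1 le_prod_encode_2)
      then obtain f g h where "encode f = a" "encode g = b" "encode h = q"
        using less q by (meson le_less_trans)
      moreover have "n = 5 + 4 * q \<or> n = 6 + 4 * q \<or> n = 7 + 4 * q \<or> n = 8 + 4 * q"
        using False unfolding q_def by presburger
      ultimately show ?thesis using ab by (metis encode.simps)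
    qed
  qed
  then show ?thesis by (metis surjI)
qed

text \<open>So \<open>encode\<close> is an effective bijective Goedel numbering, and \<open>inv encode e\<close> is the \<open>e\<close>-th program.\<close>

lemma bij_encode: "bij encode"
  by (simp add: bij_def inj_encode surj_encode)

definition W :: "nat \<Rightarrow> nat set" where
  "W e = dom (eval {} (inv encode e))"

definition re :: "nat set \<Rightarrow> bool" where
  "re A \<longleftrightarrow> (\<exists>e. A = W e)"

definition effectively_simple :: "nat set \<Rightarrow> bool" where
  "effectively_simple A \<longleftrightarrow> re A \<and> infinite (- A) \<and>
     (\<exists>f. total_recursive f \<and> (\<forall>e. W e \<subseteq> - A \<longrightarrow> finite (W e) \<and> card (W e) \<le> f e))"

definition T_complete :: "nat set \<Rightarrow> bool" where
  "T_complete A \<longleftrightarrow> re A \<and> (\<forall>B. re B \<longrightarrow> turing_reducible B A)"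


section \<open>Strings\<close>

text \<open>
  The length-lexicographic bijection (\<open>False\<close> is 0, \<open>True\<close> is 1):
  \<open>[] \<mapsto> 0\<close>, \<open>0 \<mapsto> 1\<close>, \<open>1 \<mapsto> 2\<close>, \<open>00 \<mapsto> 3\<close>, \<open>01 \<mapsto> 4\<close>, and so on.
\<close>

definition nat_of_str :: "bool list \<Rightarrow> nat" where
  "nat_of_str = foldl (\<lambda>n b. 2 * n + (if b then 2 else 1)) 0"

lemma nat_of_str_Nil [simp]: "nat_of_str [] = 0"
  and nat_of_str_snoc [simp]: "nat_of_str (x @ [b]) = 2 * nat_of_str x + (if b then 2 else 1)"
  by (simp_all add: nat_of_str_def)

lemma bij_nat_of_str: "bij nat_of_str"
proof -
  have "nat_of_str x = nat_of_str y \<Longrightarrow> x = y" for x y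
  proof (induction x arbitrary: y rule: rev_induct)
    case Nil
    then show ?case by (cases y rule: rev_cases) (auto split: if_splits)
  next
    case (snoc b x)
    then show ?case
      by (cases y rule: rev_cases) (auto split: if_splits, presburger+)
  qed
  moreover have "\<exists>x. nat_of_str x = n" for n
  proof (induction n rule: less_induct)
    case (less n)
    show ?case
    proof (cases "n = 0")
      case True
      then show ?thesis by (metis nat_of_str_Nil)
    next
      case False
      then have "(n - 1) div 2 < n" by simp
      then obtain x where x: "nat_of_str x = (n - 1) div 2" using less by blast
      have "n = 2 * ((n - 1) div 2) + (if even n then 2 else 1)" using False by presburger
      then have "nat_of_str (x @ [even n]) = n" by (simp only: nat_of_str_snoc x)
      then show ?thesis by blast
    qed
  qed
  ultimately show ?thesis by (metis bijI injI surjI)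
qed


section \<open>Kolmogorov complexity and instance complexity\<close>

text \<open>\<open>Bot\<close> is the symbol ``don't know''; it is an output, as opposed to divergence.\<close>

datatype out = Str "bool list" | Bot

fun nat_of_out :: "out \<Rightarrow> nat" where
  "nat_of_out Bot = 0"
| "nat_of_out (Str x) = Suc (nat_of_str x)"

type_synonym mapping = "bool list \<times> bool list \<rightharpoonup> out"

definition partial_recursive_mapping :: "mapping \<Rightarrow> bool" where
  "partial_recursive_mapping V \<longleftrightarrow>
     (\<exists>g. partial_recursive g \<and>
          (\<forall>p z. g (prod_encode (nat_of_str p, nat_of_str z)) = map_option nat_of_out (V (p, z))))"

text \<open>The characteristic function, with values the one-letter strings 0 and 1.\<close>

definition chi :: "bool list set \<Rightarrow> bool list \<Rightarrow> out" where
  "chi A x = Str [x \<in> A]"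

definition consistent :: "bool list set \<Rightarrow> (bool list \<rightharpoonup> out) \<Rightarrow> bool" where
  "consistent A g \<longleftrightarrow> (\<forall>x \<in> dom g. g x = Some (chi A x) \<or> g x = Some Bot)"

text \<open>The infima below are minima unless the set is empty, in which case they are \<open>\<infinity>\<close>.\<close>

definition C :: "mapping \<Rightarrow> bool list \<Rightarrow> enat" where
  "C V x = Inf {enat (length p) | p. V (p, []) = Some (Str x)}"

definition ic :: "mapping \<Rightarrow> bool list \<Rightarrow> bool list set \<Rightarrow> enat" where
  "ic V x A = Inf {enat (length p) | p.
     dom (\<lambda>z. V (p, z)) = UNIV \<and> consistent A (\<lambda>z. V (p, z)) \<and> V (p, x) = Some (chi A x)}"

definition optimal :: "mapping \<Rightarrow> bool" where
  "optimal U \<longleftrightarrow> partial_recursive_mapping U \<and>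
     (\<forall>V. partial_recursive_mapping V \<longrightarrow>
       (\<exists>d::nat. \<forall>x A. C U x \<le> C V x + enat d \<and> ic U x A \<le> ic V x A + enat d))"

text \<open>
  Subtraction on \<open>enat\<close> is truncated at 0, which does not affect the inequality since \<open>ic\<close> is never
  negative.
\<close>

definition has_hard_instances :: "mapping \<Rightarrow> bool list set \<Rightarrow> bool" where
  "has_hard_instances U A \<longleftrightarrow> (\<exists>c::nat. infinite {x. ic U x A \<ge> C U x - enat c})"

text \<open>A set of numbers viewed as a set of strings.\<close>

definition strs :: "nat set \<Rightarrow> bool list set" where
  "strs A = {x. nat_of_str x \<in> A}"

end

theory Submission
  imports Defs
begin

text \<open>
  The set \<open>A\<close> is built in stages. At some stages an event of a certain weight happens: a program of
  length \<open>k\<close> for \<open>U\<close> halts and describes some \<open>x\<close> (weight \<open>k\<close>, and \<open>x\<close> is hit), a number enters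
  \<open>W e\<close> (a weight computed from the number and \<open>e\<close>), or the requirement that \<open>A\<close> meets \<open>W e\<close> unless
  it is small acts (weight \<open>e\<close>). An event of weight \<open>k\<close> dumps into \<open>A\<close> all numbers below the current stage,
  except for stages and hit numbers of the earlier events of weight below \<open>guard (Suc k)\<close>. As there are few
  events of small weight, few numbers survive, which gives effective simplicity; and a stage with
  many survivors below it comes after all events of weight \<open>k\<close>, so \<open>A\<close> computes the halting problem.

  For instance complexity, suppose that no event of weight below \<open>T = 16 ^ i\<close> happens from some stage on.
  Then every later event of weight below \<open>16 * T\<close> freezes \<open>A\<close> below the current stage, because the guard
  takes the same value for all weights between \<open>T\<close> and \<open>16 * T\<close>. Let \<open>n t\<close> be the number of such
  events before stage \<open>t\<close>, with limit \<open>N\<close>. The \<open>j\<close>-th program waits on input \<open>z\<close> for the first \<open>t \<ge> z\<close> such that bit \<open>j\<close>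
  of \<open>n t\<close> is set, and then decides \<open>z\<close> if it had to wait. It is total if bit \<open>j\<close> of \<open>N\<close> is set, and if
  \<open>n x < N\<close>, then some bit of \<open>N\<close> is not set in \<open>n x\<close>. So logarithmically many programs serve all
  \<open>x\<close> that are ever hit with weight below \<open>16 * T\<close>, once the last event of weight below \<open>T\<close> is known.

  Knowing that event takes about \<open>T\<close> bits, too many for an \<open>x\<close> of complexity between \<open>T\<close> and
  \<open>5 * T div 4\<close>. With \<open>T = 16 * S\<close>, consider the number of events of weight below \<open>20 * S\<close> up to a multiple
  of \<open>2 ^ (8 * S)\<close>. If no event of weight below \<open>T\<close> happens after that many of them, then this number,
  of about \<open>12 * S\<close> bits, is enough to start the programs above. Otherwise, if \<open>x\<close> is at most
  the last event of weight below \<open>T\<close>, then it is served by the programs for \<open>S\<close> in place of \<open>T\<close>; and if not, then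
  fewer than \<open>2 ^ (8 * S)\<close> hits come between that event and the hit of \<open>x\<close>, and their number
  tells a program how long to wait.
\<close>

section \<open>Computable functions\<close>

text \<open>One notion of computability then covers numbers, truth values and nested pairs, and
  closure rules can be applied to lambda terms syntactically.\<close>

class coded =
  fixes code :: "'a \<Rightarrow> nat"
  assumes inj_code: "code x = code y \<Longrightarrow> x = y"

instantiation nat :: coded
begin
definition code_nat_def [simp]: "code (n::nat) = n"
instance by standard simp
end

instantiation bool :: coded
begin
definition code_bool_def: "code b = (of_bool b :: nat)"
instance by standard (simp add: code_bool_def of_bool_def split: if_splits)
end

instantiation prod :: (coded, coded) coded
begin
definition code_prod_def: "code p = prod_encode (code (fst p), code (snd p))"
instance by standard (auto simp: code_prod_def inj_code prod_eq_iff)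
end

text \<open>Restricted to total functions; divergence arises only from a final unbounded
  search.\<close>

definition computable_in :: "nat set \<Rightarrow> ('a::coded \<Rightarrow> 'b::coded) \<Rightarrow> bool" where
  "computable_in X f \<longleftrightarrow> (\<exists>c. \<forall>x. eval X c (code x) = Some (code (f x)))"

lemma computable_in_comp:
  assumes "computable_in X f" "computable_in X g"
  shows "computable_in X (\<lambda>x. f (g x))"
proof -
  obtain c d where "\<forall>x. eval X c (code x) = Some (code (f x))"
    "\<forall>x. eval X d (code x) = Some (code (g x))"
    using assms unfolding computable_in_def by blast
  then have "\<forall>x. eval X (Compose c d) (code x) = Some (code (f (g x)))" by simp
  then show ?thesis unfolding computable_in_def by blast
qed

lemma computable_in_id: "computable_in X (\<lambda>x. x)"
proof -
  \<comment> \<open>Pairing the two decoded components gives the argument back, so this program is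
    the identity.\<close>
  have "\<forall>x::'a. eval X (Tuple First Second) (code x) = Some (code x)" by simp
  then show ?thesis unfolding computable_in_def by blast
qed

lemma computable_in_const: "computable_in X (\<lambda>x. c)"
proof -
  have "\<exists>d. \<forall>x. eval X d x = Some n" for n
  proof (induction n)
    case 0
    have "\<forall>x. eval X Zero x = Some 0" by simp
    then show ?case by blast
  next
    case (Suc n)
    then obtain d where "\<forall>x. eval X d x = Some n" by blast
    then have "\<forall>x. eval X (Compose Successor d) x = Some (Suc n)" by simp
    then show ?case by blast
  qed
  then show ?thesis unfolding computable_in_def by blast
qed

lemma computable_in_Pair:
  assumes "computable_in X f" "computable_in X g"
  shows "computable_in X (\<lambda>x. (f x, g x))"
proof -
  obtain c d where "\<forall>x. eval X c (code x) = Some (code (f x))"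
    "\<forall>x. eval X d (code x) = Some (code (g x))"
    using assms unfolding computable_in_def by blast
  then have "\<forall>x. eval X (Tuple c d) (code x) = Some (code (f x, g x))"
    by (simp add: code_prod_def)
  then show ?thesis unfolding computable_in_def by blast
qed


text \<open>Resolved with a fact about a binary operation on pairs, it yields the introduction rule
  for that operation applied to two computable functions.\<close>

lemma computable_in_comp2:
  assumes "computable_in X (\<lambda>p. h (fst p) (snd p))" "computable_in X f" "computable_in X g"
  shows "computable_in X (\<lambda>x. h (f x) (g x))"
  using computable_in_comp[OF assms(1) computable_in_Pair[OF assms(2,3)]] by simp

lemma computable_in_evalI: "(\<And>x. eval X c (code x) = Some (code (f x))) \<Longrightarrow> computable_in X f"
  unfolding computable_in_def by blast

lemma computable_in_fst: "computable_in X f \<Longrightarrow> computable_in X (\<lambda>x. fst (f x))"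
  by (rule computable_in_comp[OF computable_in_evalI[where c = First]]) (simp_all add: code_prod_def)

lemma computable_in_snd: "computable_in X f \<Longrightarrow> computable_in X (\<lambda>x. snd (f x))"
  by (rule computable_in_comp[OF computable_in_evalI[where c = Second]]) (simp_all add: code_prod_def)

lemma computable_in_Suc: "computable_in X f \<Longrightarrow> computable_in X (\<lambda>x. Suc (f x))"
  by (rule computable_in_comp[OF computable_in_evalI[where c = Successor]]) simp_all

lemma computable_in_mem: "computable_in X f \<Longrightarrow> computable_in X (\<lambda>x. f x \<in> X)"
  by (rule computable_in_comp[OF computable_in_evalI[where c = Oracle]]) (simp_all add: code_bool_def)

lemma computable_in_prod_encode:
  "computable_in X f \<Longrightarrow> computable_in X (\<lambda>x. prod_encode (f x))"
  by (rule computable_in_comp[OF computable_in_evalI[where c = "Tuple First Second"]])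
    (simp_all add: code_prod_def)

lemma computable_in_prod_decode:
  "computable_in X f \<Longrightarrow> computable_in X (\<lambda>x. prod_decode (f x))"
  by (rule computable_in_comp[OF computable_in_evalI[where c = "Tuple First Second"]])
    (simp_all add: code_prod_def)

lemma computable_in_of_bool:
  "computable_in X f \<Longrightarrow> computable_in X (\<lambda>x. of_bool (f x) :: nat)"
  by (rule computable_in_comp[OF computable_in_evalI[where c = "Tuple First Second"]])
    (simp_all add: code_bool_def)

lemma computable_in_rec_nat:
  assumes f: "computable_in X f" and g: "computable_in X (\<lambda>u. g (fst u) (fst (snd u)) (snd (snd u)))"
    and m: "computable_in X m"
  shows "computable_in X (\<lambda>x. rec_nat (f x) (g x) (m x))"
proof -
  obtain cf cg where cf: "\<And>x. eval X cf (code x) = Some (code (f x))"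
    and cg: "\<And>u. eval X cg (code u) = Some (code (g (fst u) (fst (snd u)) (snd (snd u))))"
    using f g unfolding computable_in_def by blast
  have cg': "eval X cg (prod_encode (code x, prod_encode (k, code r))) = Some (code (g x k r))" for x k r
    using cg[of "(x, k, r)"] by (simp add: code_prod_def)
  have "rec_nat (eval X cf (code x))
      (\<lambda>k r. Option.bind r (\<lambda>v. eval X cg (prod_encode (code x, prod_encode (k, v))))) n
    = Some (code (rec_nat (f x) (g x) n))" for x n
    by (induction n) (simp_all add: cf cg')
  then have "computable_in X (\<lambda>p. rec_nat (f (fst p)) (g (fst p)) (snd p))"
    by (intro computable_in_evalI[where c = "PrimRec cf cg"]) (simp add: code_prod_def)
  from computable_in_comp[OF this computable_in_Pair[OF computable_in_id m]] show ?thesis by simp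
qed

lemma computable_in_if:
  assumes "computable_in X P" "computable_in X f" "computable_in X g"
  shows "computable_in X (\<lambda>x. if P x then f x else g x)"
proof -
  \<comment> \<open>A recursion of length 0 or 1 acts as the case distinction.\<close>
  have "computable_in X (\<lambda>x. rec_nat (g x) (\<lambda>_ _. f x) (of_bool (P x)))"
    by (intro computable_in_rec_nat computable_in_of_bool assms
      computable_in_comp[OF assms(2)] computable_in_fst computable_in_id)
  also have "(\<lambda>x. rec_nat (g x) (\<lambda>_ _. f x) (of_bool (P x))) = (\<lambda>x. if P x then f x else g x)"
    by auto
  finally show ?thesis .
qed

lemma computable_in_not:
  assumes "computable_in X P"
  shows "computable_in X (\<lambda>x. \<not> P x)"
proof -
  have "(\<lambda>x. \<not> P x) = (\<lambda>x. if P x then False else True)" by auto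
  then show ?thesis using assms by (simp only:) (intro computable_in_if computable_in_const)
qed

lemma computable_in_conj:
  assumes "computable_in X P" "computable_in X Q"
  shows "computable_in X (\<lambda>x. P x \<and> Q x)"
proof -
  have "(\<lambda>x. P x \<and> Q x) = (\<lambda>x. if P x then Q x else False)" by auto
  then show ?thesis using assms by (simp only:) (intro computable_in_if computable_in_const)
qed

lemma computable_in_disj:
  assumes "computable_in X P" "computable_in X Q"
  shows "computable_in X (\<lambda>x. P x \<or> Q x)"
proof -
  have "(\<lambda>x. P x \<or> Q x) = (\<lambda>x. if P x then True else Q x)" by auto
  then show ?thesis using assms by (simp only:) (intro computable_in_if computable_in_const)
qed

lemma computable_in_imp:
  assumes "computable_in X P" "computable_in X Q"
  shows "computable_in X (\<lambda>x. P x \<longrightarrow> Q x)"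
  unfolding imp_conv_disj by (intro computable_in_disj computable_in_not assms)

lemmas computable_in_basic =
  computable_in_id computable_in_const computable_in_Pair computable_in_fst computable_in_snd
  computable_in_Suc computable_in_mem computable_in_prod_encode computable_in_prod_decode
  computable_in_of_bool computable_in_rec_nat computable_in_if computable_in_not computable_in_conj
  computable_in_disj computable_in_imp

section \<open>Arithmetic and bounded quantification\<close>

lemma computable_in_add [THEN computable_in_comp2]:
  "computable_in X (\<lambda>p. fst p + snd p :: nat)"
proof -
  have eq: "a + b = rec_nat a (\<lambda>k r. Suc r) b" for a b by (induction b) auto
  show ?thesis unfolding eq by (intro computable_in_basic)
qed

lemma computable_in_diff [THEN computable_in_comp2]:
  "computable_in X (\<lambda>p. fst p - snd p :: nat)"
proof -
  have pred: "n - 1 = rec_nat 0 (\<lambda>k r. k) n" for n :: nat by (induction n) auto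
  have diff: "a - b = rec_nat a (\<lambda>k r. r - 1) b" for a b :: nat by (induction b) auto
  have eq: "a - b = rec_nat a (\<lambda>k r. rec_nat 0 (\<lambda>k r. k) r) b" for a b :: nat
    by (simp only: diff[of a b] pred)
  show ?thesis unfolding eq by (intro computable_in_basic)
qed

lemma computable_in_mult [THEN computable_in_comp2]:
  "computable_in X (\<lambda>p. fst p * snd p :: nat)"
proof -
  have eq: "a * b = rec_nat 0 (\<lambda>k r. r + a) b" for a b :: nat by (induction b) auto
  show ?thesis unfolding eq by (intro computable_in_basic computable_in_add)
qed

lemma computable_in_power [THEN computable_in_comp2]:
  "computable_in X (\<lambda>p. fst p ^ snd p :: nat)"
proof -
  have eq: "a ^ b = rec_nat 1 (\<lambda>k r. r * a) b" for a b :: nat by (induction b) auto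
  show ?thesis unfolding eq by (intro computable_in_basic computable_in_mult)
qed

lemma computable_in_le [THEN computable_in_comp2]:
  "computable_in X (\<lambda>p. fst p \<le> (snd p :: nat))"
proof -
  have eq: "a \<le> b \<longleftrightarrow> rec_nat True (\<lambda>_ _. False) (a - b)" for a b :: nat by (cases "a - b") auto
  show ?thesis unfolding eq by (intro computable_in_basic computable_in_diff)
qed

lemma computable_in_less:
  "computable_in X f \<Longrightarrow> computable_in X g \<Longrightarrow> computable_in X (\<lambda>x. f x < (g x :: nat))"
  unfolding Suc_le_eq[symmetric] by (intro computable_in_le computable_in_Suc)

lemma computable_in_eq:
  "computable_in X f \<Longrightarrow> computable_in X g \<Longrightarrow> computable_in X (\<lambda>x. f x = (g x :: nat))"
  unfolding eq_iff by (intro computable_in_le computable_in_conj)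

lemma computable_in_bex:
  fixes P :: "'a::coded \<Rightarrow> nat \<Rightarrow> bool"
  assumes "computable_in X b" "computable_in X (\<lambda>u. P (fst u) (snd u))"
  shows "computable_in X (\<lambda>x. \<exists>i<b x. P x i)"
proof -
  have eq: "(\<exists>i<n. P x i) \<longleftrightarrow> rec_nat False (\<lambda>k r. r \<or> P x k) n" for x n
    by (induction n) (auto simp: less_Suc_eq)
  show ?thesis
    unfolding eq by (intro computable_in_basic assms computable_in_comp2[OF assms(2)])
qed

lemma computable_in_ball:
  fixes P :: "'a::coded \<Rightarrow> nat \<Rightarrow> bool"
  assumes "computable_in X b" "computable_in X (\<lambda>u. P (fst u) (snd u))"
  shows "computable_in X (\<lambda>x. \<forall>i<b x. P x i)"
  using computable_in_not[OF computable_in_bex[OF assms(1) computable_in_not[OF assms(2)]]]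
  by simp

text \<open>Counting replaces bounded search: quotients, string lengths and the guard are written as
  cardinalities in order to fall under this rule.\<close>

lemma computable_in_card:
  fixes P :: "'a::coded \<Rightarrow> nat \<Rightarrow> bool"
  assumes "computable_in X b" "computable_in X (\<lambda>u. P (fst u) (snd u))"
  shows "computable_in X (\<lambda>x. card {i. i < b x \<and> P x i})"
proof -
  have eq: "card {i. i < n \<and> P x i} = rec_nat 0 (\<lambda>k r. r + of_bool (P x k)) n" for x n
  proof (induction n)
    case (Suc n)
    have "{i. i < Suc n \<and> P x i} = (if P x n then insert n {i. i < n \<and> P x i} else {i. i < n \<and> P x i})"
      by (auto simp: less_Suc_eq)
    then show ?case using Suc by simp
  qed simp
  show ?thesis
    unfolding eq by (intro computable_in_basic computable_in_add assms computable_in_comp2[OF assms(2)])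
qed

lemma computable_in_div [THEN computable_in_comp2]:
  "computable_in X (\<lambda>p. fst p div snd p :: nat)"
proof -
  \<comment> \<open>The quotient is the number of positive multiples of \<open>b\<close> up to
    \<open>a\<close>; division by zero yields 0 and is treated apart.\<close>
  have eq: "a div b = (if b = 0 then 0 else card {i. i < a \<and> (i + 1) * b \<le> a})" for a b :: nat
  proof (cases "b = 0")
    case False
    have 1: "(i + 1) * b \<le> a \<longleftrightarrow> i < a div b" for i
      using less_eq_div_iff_mult_less_eq[of b "i + 1" a] False by auto
    have 2: "a div b \<le> a" by simp
    have "{i. i < a \<and> (i + 1) * b \<le> a} = {..<a div b}"
      unfolding 1 using 2 by (intro set_eqI) (simp only: mem_Collect_eq lessThan_iff, linarith)
    then show ?thesis using False by simp
  qed simp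
  show ?thesis
    unfolding eq by (intro computable_in_basic computable_in_add computable_in_mult
      computable_in_eq computable_in_le computable_in_card)
qed

lemma computable_in_mod:
  "computable_in X f \<Longrightarrow> computable_in X g \<Longrightarrow> computable_in X (\<lambda>x. f x mod g x :: nat)"
  unfolding minus_div_mult_eq_mod[symmetric]
  by (intro computable_in_diff computable_in_mult computable_in_div)

lemma computable_in_even: "computable_in X f \<Longrightarrow> computable_in X (\<lambda>x. even (f x :: nat))"
  unfolding even_iff_mod_2_eq_zero by (intro computable_in_eq computable_in_mod computable_in_const)

lemmas computable_in_intros = computable_in_basic
  computable_in_add computable_in_diff computable_in_mult computable_in_power computable_in_le
  computable_in_less computable_in_eq computable_in_bex computable_in_ball computable_in_card
  computable_in_div computable_in_mod computable_in_even

subsection \<open>Course-of-values recursion\<close>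

primrec history :: "(nat \<Rightarrow> (nat \<Rightarrow> nat) \<Rightarrow> nat) \<Rightarrow> nat \<Rightarrow> nat \<Rightarrow> nat" where
  "history \<Phi> 0 = (\<lambda>_. 0)"
| "history \<Phi> (Suc s) = (history \<Phi> s)(s := \<Phi> s (history \<Phi> s))"

definition course :: "(nat \<Rightarrow> (nat \<Rightarrow> nat) \<Rightarrow> nat) \<Rightarrow> nat \<Rightarrow> nat" where
  "course \<Phi> s = \<Phi> s (history \<Phi> s)"

lemma history_eq: "history \<Phi> s = (\<lambda>i. if i < s then course \<Phi> i else 0)"
proof (induction s)
  case (Suc s)
  have "history \<Phi> (Suc s) = (history \<Phi> s)(s := course \<Phi> s)" by (simp add: course_def)
  then show ?case by (simp only: Suc) (rule ext, simp)
qed simp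

text \<open>The step function sees the default 0 from stage \<open>s\<close> on. The recursions
  below ask only about earlier stages, so the cutoff can be removed from them.\<close>

lemma course_eq: "course \<Phi> s = \<Phi> s (\<lambda>i. if i < s then course \<Phi> i else 0)"
  by (simp only: course_def[of \<Phi> s] history_eq)

text \<open>A history is coded by iterated pairing, the latest value first.\<close>

definition entry :: "nat \<Rightarrow> nat \<Rightarrow> nat \<Rightarrow> nat" where
  "entry s h i = (if i < s
     then fst (prod_decode (rec_nat h (\<lambda>_ r. snd (prod_decode r)) (s - 1 - i))) else 0)"

lemma computable_in_entry:
  "computable_in X f \<Longrightarrow> computable_in X g \<Longrightarrow> computable_in X h \<Longrightarrow>
   computable_in X (\<lambda>x. entry (f x) (g x) (h x))"
  unfolding entry_def by (intro computable_in_intros)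

lemma entry_Suc: "entry (Suc s) (prod_encode (v, h)) i = (if i = s then v else entry s h i)"
proof -
  have "rec_nat (prod_encode (v, h)) (\<lambda>_ r. snd (prod_decode r)) (Suc n)
      = rec_nat h (\<lambda>_ r. snd (prod_decode r)) n" for n
    by (induction n) auto
  moreover have "Suc s - 1 - i = Suc (s - 1 - i)" if "i < s" using that by simp
  ultimately show ?thesis unfolding entry_def
    by (cases i s rule: linorder_cases) (simp_all del: diff_Suc_1)
qed

lemma computable_in_course:
  assumes "computable_in X (\<lambda>u. \<Phi> (fst u) (entry (fst u) (snd u)))"
  shows "computable_in X (course \<Phi>)"
proof -
  \<comment> \<open>\<open>H s\<close> codes the first \<open>s\<close> values as one number, so an
    ordinary primitive recursion suffices.\<close>
  define H where "H = rec_nat 0 (\<lambda>s h. prod_encode (\<Phi> s (entry s h), h))"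
  have "entry s (H s) = history \<Phi> s" for s
  proof (induction s)
    case 0
    then show ?case by (auto simp: entry_def)
  next
    case (Suc s)
    have "H (Suc s) = prod_encode (\<Phi> s (entry s (H s)), H s)" by (simp add: H_def)
    then show ?case by (intro ext) (simp only: entry_Suc Suc history.simps fun_upd_apply)
  qed
  then have "course \<Phi> = (\<lambda>s. \<Phi> s (entry s (H s)))" by (simp add: course_def [abs_def])
  moreover note comp = computable_in_comp2[where h = "\<lambda>s h. \<Phi> s (entry s h)", OF assms]
  have "computable_in X (\<lambda>s. \<Phi> s (entry s (H s)))"
    unfolding H_def
    by (intro comp computable_in_intros)
  ultimately show ?thesis by simp
qed

subsection \<open>Unbounded search\<close>

lemma computable_in_search:
  fixes P :: "'a::coded \<Rightarrow> nat \<Rightarrow> bool" and f :: "'a \<Rightarrow> nat \<Rightarrow> 'b::coded"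
  assumes "computable_in X (\<lambda>u. P (fst u) (snd u))" "computable_in X (\<lambda>u. f (fst u) (snd u))"
  shows "\<exists>c. \<forall>x. eval X c (code x) =
    (if \<exists>t. P x t then Some (code (f x (LEAST t. P x t))) else None)"
proof -
  \<comment> \<open>\<open>Minimise\<close> looks for a zero and the code of \<open>False\<close> is
    0, hence the negation.\<close>
  obtain cp where cp: "\<And>u. eval X cp (code u) = Some (code (\<not> P (fst u) (snd u)))"
    using computable_in_not[OF assms(1)] unfolding computable_in_def by blast
  obtain cf where cf: "\<And>u. eval X cf (code u) = Some (code (f (fst u) (snd u)))"
    using assms(2) unfolding computable_in_def by blast
  have cp': "eval X cp (prod_encode (code x, t)) = Some (of_bool (\<not> P x t))" for x t
    using cp[of "(x, t)"] by (simp add: code_prod_def code_bool_def)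
  have cf': "eval X cf (prod_encode (code x, t)) = Some (code (f x t))" for x t
    using cf[of "(x, t)"] by (simp add: code_prod_def)
  have "eval X (Minimise cp) (code x) = (if \<exists>t. P x t then Some (LEAST t. P x t) else None)" for x
  proof -
    have "(\<exists>m. P x m \<and> (\<forall>k<m. \<not> P x k)) \<longleftrightarrow> (\<exists>t. P x t)"
      by (metis LeastI not_less_Least)
    then show ?thesis by (simp add: cp')
  qed
  then have "eval X (Compose cf (Tuple (Tuple First Second) (Minimise cp))) (code x) =
    (if \<exists>t. P x t then Some (code (f x (LEAST t. P x t))) else None)" for x
    by (simp add: cf')
  then show ?thesis by blast
qed

section \<open>A universal enumeration\<close>

text \<open>Stage \<open>s\<close> proposes that program \<open>stage_prog s\<close> maps \<open>stage_in s\<close> to \<open>stage_out s\<close>; every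
  proposal recurs at infinitely many stages.\<close>

definition stage_prog :: "nat \<Rightarrow> nat" where
  "stage_prog s = fst (prod_decode s)"
definition stage_in :: "nat \<Rightarrow> nat" where
  "stage_in s = fst (prod_decode (snd (prod_decode s)))"
definition stage_out :: "nat \<Rightarrow> nat" where
  "stage_out s = fst (prod_decode (snd (prod_decode (snd (prod_decode s)))))"

lemma computable_in_stage:
  "computable_in X f \<Longrightarrow> computable_in X (\<lambda>x. stage_prog (f x))"
  "computable_in X f \<Longrightarrow> computable_in X (\<lambda>x. stage_in (f x))"
  "computable_in X f \<Longrightarrow> computable_in X (\<lambda>x. stage_out (f x))"
  unfolding stage_prog_def stage_in_def stage_out_def by (intro computable_in_intros; assumption)+

lemma stage_le: "stage_prog s \<le> s" "stage_in s \<le> s" "stage_out s \<le> s"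
proof -
  have *: "fst (prod_decode m) \<le> m" "snd (prod_decode m) \<le> m" for m
    by (metis le_prod_encode_1 le_prod_encode_2 prod.collapse prod_decode_inverse)+
  show "stage_prog s \<le> s" "stage_in s \<le> s" "stage_out s \<le> s"
    unfolding stage_prog_def stage_in_def stage_out_def by (meson * order_trans)+
qed

lemma stage_exists: "\<exists>s\<ge>B. stage_prog s = e \<and> stage_in s = n \<and> stage_out s = y"
proof -
  let ?s = "prod_encode (e, prod_encode (n, prod_encode (y, B)))"
  have "B \<le> ?s" by (meson le_prod_encode_2 order_trans)
  then show ?thesis
    by (intro exI[of _ ?s]) (simp add: stage_prog_def stage_in_def stage_out_def)
qed

definition known :: "nat \<Rightarrow> (nat \<Rightarrow> bool) \<Rightarrow> nat \<Rightarrow> nat \<Rightarrow> nat \<Rightarrow> bool" where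
  "known s g e n y \<longleftrightarrow> (\<exists>i<s. g i \<and> stage_prog i = e \<and> stage_in i = n \<and> stage_out i = y)"

text \<open>One step of the evaluation of the program with number \<open>e\<close>; \<open>(e - 5) mod 4\<close> is its outermost
  constructor and \<open>(e - 5) div 4\<close> codes its arguments. The condition for \<open>Minimise\<close> comes last.\<close>

definition justified :: "nat \<Rightarrow> (nat \<Rightarrow> bool) \<Rightarrow> nat \<Rightarrow> nat \<Rightarrow> nat \<Rightarrow> bool" where
  "justified s g e n y \<longleftrightarrow>
    (if e = 0 then y = 0 else if e = 1 then y = Suc n else if e = 2 then y = fst (prod_decode n)
     else if e = 3 then y = snd (prod_decode n) else if e = 4 then y = 0
     else if (e - 5) mod 4 = 0 then
       known s g (fst (prod_decode ((e - 5) div 4))) n (fst (prod_decode y)) \<and>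
       known s g (snd (prod_decode ((e - 5) div 4))) n (snd (prod_decode y))
     else if (e - 5) mod 4 = 1 then
       (\<exists>i<s. g i \<and> stage_prog i = snd (prod_decode ((e - 5) div 4)) \<and> stage_in i = n \<and>
          known s g (fst (prod_decode ((e - 5) div 4))) (stage_out i) y)
     else if (e - 5) mod 4 = 2 then
       (if snd (prod_decode n) = 0
        then known s g (fst (prod_decode ((e - 5) div 4))) (fst (prod_decode n)) y
        else \<exists>i<s. g i \<and> stage_prog i = e \<and>
          stage_in i = prod_encode (fst (prod_decode n), snd (prod_decode n) - 1) \<and>
          known s g (snd (prod_decode ((e - 5) div 4)))
            (prod_encode (fst (prod_decode n), prod_encode (snd (prod_decode n) - 1, stage_out i))) y)
     else known s g ((e - 5) div 4) (prod_encode (n, y)) 0 \<and>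
       (\<forall>k<y. \<exists>i<s. g i \<and> stage_prog i = (e - 5) div 4 \<and> stage_in i = prod_encode (n, k) \<and>
          0 < stage_out i))"

text \<open>Earlier accepted proposals must justify the new one, so an accepted stage ends a finite
  derivation of its value.\<close>

definition accepted :: "nat \<Rightarrow> bool" where
  "accepted s \<longleftrightarrow>
     course (\<lambda>s (g :: nat \<Rightarrow> nat). of_bool (justified s (\<lambda>i. g i = 1) (stage_prog s) (stage_in s) (stage_out s))) s = 1"

lemma computable_in_known:
  assumes "computable_in X f" "computable_in X (\<lambda>u. g (fst u) (snd u))" "computable_in X e"
    "computable_in X n" "computable_in X y"
  shows "computable_in X (\<lambda>x. known (f x) (g x) (e x) (n x) (y x))"
  unfolding known_def
  by (intro computable_in_bex computable_in_conj computable_in_eq computable_in_stage computable_in_snd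
    computable_in_id assms computable_in_const assms(3-)[THEN computable_in_comp] computable_in_fst)

lemma computable_in_accepted:
  "computable_in X f \<Longrightarrow> computable_in X (\<lambda>x. accepted (f x))"
  unfolding accepted_def
  apply (intro computable_in_eq computable_in_const computable_in_comp[OF computable_in_course])
   apply (unfold justified_def)
   apply (intro computable_in_known computable_in_intros computable_in_stage computable_in_entry)
   apply assumption
   done

lemma justified_cong:
  assumes "\<And>i. i < s \<Longrightarrow> g i \<longleftrightarrow> h i"
  shows "justified s g e n y \<longleftrightarrow> justified s h e n y"
proof -
  have "(\<exists>i<s. g i \<and> P i) \<longleftrightarrow> (\<exists>i<s. h i \<and> P i)" for P using assms by blast
  then show ?thesis unfolding justified_def known_def by (simp only:)
qed

lemma accepted_iff:
  "accepted s \<longleftrightarrow> justified s accepted (stage_prog s) (stage_in s) (stage_out s)"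
proof -
  define \<Phi> where "\<Phi> = (\<lambda>s (g :: nat \<Rightarrow> nat). of_bool (justified s (\<lambda>i. g i = 1) (stage_prog s) (stage_in s) (stage_out s)) :: nat)"
  have acc: "accepted s \<longleftrightarrow> course \<Phi> s = 1" for s by (simp add: accepted_def \<Phi>_def)
  have "course \<Phi> s = \<Phi> s (\<lambda>i. if i < s then course \<Phi> i else 0)"
    by (rule course_eq)
  also have "\<dots> = of_bool (justified s accepted (stage_prog s) (stage_in s) (stage_out s))"
  proof -
    have "justified s (\<lambda>i. (if i < s then course \<Phi> i else 0) = 1) e n y \<longleftrightarrow> justified s accepted e n y" for e n y
      by (rule justified_cong) (simp add: acc)
    then show ?thesis by (subst \<Phi>_def) (simp only:)
  qed
  finally show ?thesis unfolding acc[of s] by simp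
qed

section \<open>Acceptance agrees with evaluation\<close>

lemma accepted_atomic:
  "stage_prog s = encode Zero \<Longrightarrow> accepted s \<longleftrightarrow> stage_out s = 0"
  "stage_prog s = encode Successor \<Longrightarrow> accepted s \<longleftrightarrow> stage_out s = Suc (stage_in s)"
  "stage_prog s = encode First \<Longrightarrow> accepted s \<longleftrightarrow> stage_out s = fst (prod_decode (stage_in s))"
  "stage_prog s = encode Second \<Longrightarrow> accepted s \<longleftrightarrow> stage_out s = snd (prod_decode (stage_in s))"
  "stage_prog s = encode Oracle \<Longrightarrow> accepted s \<longleftrightarrow> stage_out s = 0"
  unfolding accepted_iff[of s] justified_def by simp_all

lemma constructor_code:
  fixes q :: nat
  shows "(5 + 4 * q - 5) mod 4 = 0" "(5 + 4 * q - 5) div 4 = q"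
    "(6 + 4 * q - 5) mod 4 = 1" "(6 + 4 * q - 5) div 4 = q"
    "(7 + 4 * q - 5) mod 4 = 2" "(7 + 4 * q - 5) div 4 = q"
    "(8 + 4 * q - 5) mod 4 = 3" "(8 + 4 * q - 5) div 4 = q"
proof -
  have *: "5 + 4 * q - 5 = 0 + q * 4" "6 + 4 * q - 5 = 1 + q * 4" "7 + 4 * q - 5 = 2 + q * 4"
    "8 + 4 * q - 5 = 3 + q * 4" by linarith+
  show "(5 + 4 * q - 5) mod 4 = 0" "(5 + 4 * q - 5) div 4 = q"
    "(6 + 4 * q - 5) mod 4 = 1" "(6 + 4 * q - 5) div 4 = q"
    "(7 + 4 * q - 5) mod 4 = 2" "(7 + 4 * q - 5) div 4 = q"
    "(8 + 4 * q - 5) mod 4 = 3" "(8 + 4 * q - 5) div 4 = q"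
    unfolding * mod_mult_self1 by simp_all
qed

lemma accepted_Tuple:
  assumes "stage_prog s = encode (Tuple f g)"
  shows "accepted s \<longleftrightarrow>
    (\<exists>i<s. accepted i \<and> stage_prog i = encode f \<and> stage_in i = stage_in s \<and>
       stage_out i = fst (prod_decode (stage_out s))) \<and>
    (\<exists>i<s. accepted i \<and> stage_prog i = encode g \<and> stage_in i = stage_in s \<and>
       stage_out i = snd (prod_decode (stage_out s)))"
  unfolding accepted_iff[of s] assms encode.simps justified_def known_def constructor_code by simp

lemma accepted_Compose:
  assumes "stage_prog s = encode (Compose f g)"
  shows "accepted s \<longleftrightarrow>
    (\<exists>i<s. accepted i \<and> stage_prog i = encode g \<and> stage_in i = stage_in s \<and>
      (\<exists>j<s. accepted j \<and> stage_prog j = encode f \<and> stage_in j = stage_out i \<and> stage_out j = stage_out s))"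
  unfolding accepted_iff[of s] assms encode.simps justified_def known_def constructor_code by simp

lemma accepted_PrimRec:
  assumes "stage_prog s = encode (PrimRec f g)" and "stage_in s = prod_encode (a, m)"
  shows "accepted s \<longleftrightarrow> (case m of
      0 \<Rightarrow> \<exists>i<s. accepted i \<and> stage_prog i = encode f \<and> stage_in i = a \<and> stage_out i = stage_out s
    | Suc k \<Rightarrow> \<exists>i<s. accepted i \<and> stage_prog i = encode (PrimRec f g) \<and> stage_in i = prod_encode (a, k) \<and>
      (\<exists>j<s. accepted j \<and> stage_prog j = encode g \<and>
         stage_in j = prod_encode (a, prod_encode (k, stage_out i)) \<and> stage_out j = stage_out s))"
  unfolding accepted_iff[of s] assms encode.simps justified_def known_def constructor_code
  by (cases m) simp_all

lemma accepted_Minimise: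
  assumes "stage_prog s = encode (Minimise f)"
  shows "accepted s \<longleftrightarrow>
    (\<exists>i<s. accepted i \<and> stage_prog i = encode f \<and> stage_in i = prod_encode (stage_in s, stage_out s) \<and>
       stage_out i = 0) \<and>
    (\<forall>k<stage_out s. \<exists>i<s. accepted i \<and> stage_prog i = encode f \<and>
       stage_in i = prod_encode (stage_in s, k) \<and> 0 < stage_out i)"
  unfolding accepted_iff[of s] assms encode.simps justified_def known_def constructor_code by simp

text \<open>The induction runs over stages rather than programs, since a primitive recursion is
  justified by an earlier stage of the same program.\<close>

lemma accepted_sound:
  "accepted s \<Longrightarrow> stage_prog s = encode c \<Longrightarrow> eval {} c (stage_in s) = Some (stage_out s)"
proof (induction s arbitrary: c rule: less_induct)
  case (less s)
  note IH = less.IH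
  show ?case
  proof (cases c)
    case (Tuple f g)
    then obtain i j where "i < s" "accepted i" "stage_prog i = encode f" "stage_in i = stage_in s"
       "stage_out i = fst (prod_decode (stage_out s))"
       "j < s" "accepted j" "stage_prog j = encode g" "stage_in j = stage_in s"
       "stage_out j = snd (prod_decode (stage_out s))"
      using less.prems accepted_Tuple[of s f g] by auto
    then show ?thesis using IH[of i f] IH[of j g] Tuple by simp
  next
    case (Compose f g)
    then obtain i j where "i < s" "accepted i" "stage_prog i = encode g" "stage_in i = stage_in s"
       "j < s" "accepted j" "stage_prog j = encode f" "stage_in j = stage_out i"
       "stage_out j = stage_out s"
      using less.prems accepted_Compose[of s f g] by auto
    then show ?thesis using IH[of i g] IH[of j f] Compose by simp
  next
    case (PrimRec f g)
    obtain a m where am: "stage_in s = prod_encode (a, m)"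
      by (metis prod_decode_inverse surj_pair)
    show ?thesis
    proof (cases m)
      case 0
      then obtain i where "i < s" "accepted i" "stage_prog i = encode f" "stage_in i = a"
        "stage_out i = stage_out s"
        using less.prems accepted_PrimRec[of s f g a m] PrimRec am by auto
      then show ?thesis using IH[of i f] PrimRec am 0 by simp
    next
      case (Suc k)
      then obtain i j where "i < s" "accepted i" "stage_prog i = encode (PrimRec f g)"
        "stage_in i = prod_encode (a, k)" "j < s" "accepted j" "stage_prog j = encode g"
        "stage_in j = prod_encode (a, prod_encode (k, stage_out i))" "stage_out j = stage_out s"
        using less.prems accepted_PrimRec[of s f g a m] PrimRec am by auto
      then show ?thesis using IH[of i "PrimRec f g"] IH[of j g] PrimRec am Suc by simp
    qed
  next
    case (Minimise f)
    then have 1: "\<exists>i<s. accepted i \<and> stage_prog i = encode f \<and>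
        stage_in i = prod_encode (stage_in s, stage_out s) \<and> stage_out i = 0"
      and 2: "\<forall>k<stage_out s. \<exists>i<s. accepted i \<and> stage_prog i = encode f \<and>
       stage_in i = prod_encode (stage_in s, k) \<and> 0 < stage_out i"
      using less.prems accepted_Minimise[of s f] by auto
    have 3: "eval {} f (prod_encode (stage_in s, stage_out s)) = Some 0" using 1 IH by metis
    have 4: "\<exists>v>0. eval {} f (prod_encode (stage_in s, k)) = Some v" if "k < stage_out s" for k
      using 2 that IH by metis
    have "(LEAST m. eval {} f (prod_encode (stage_in s, m)) = Some 0) = stage_out s"
    proof (rule Least_equality)
      fix m assume "eval {} f (prod_encode (stage_in s, m)) = Some 0"
      then show "stage_out s \<le> m" using 4[of m] by (cases "stage_out s \<le> m") auto
    qed (fact 3)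
    then show ?thesis using 3 4 Minimise by auto
  qed (use less.prems in \<open>simp_all add: accepted_iff[of s] justified_def\<close>)
qed

lemma bounded_witnesses:
  fixes P :: "nat \<Rightarrow> nat \<Rightarrow> bool"
  shows "(\<forall>k<m. \<exists>i. P k i) \<Longrightarrow> \<exists>N. \<forall>k<m. \<exists>i<N. P k i"
proof (induction m)
  case (Suc m)
  then obtain N where N: "\<forall>k<m. \<exists>i<N. P k i" by auto
  obtain i where "P m i" using Suc by blast
  then have "\<forall>k<Suc m. \<exists>j<max N (Suc i). P k j"
    using N by (metis less_Suc_eq max.strict_coboundedI1 max.strict_coboundedI2 lessI)
  then show ?case by blast
qed simp

text \<open>Every proposal recurs beyond any bound, in particular after all stages that justify it.
  Primitive recursion takes an inner induction on its recursion argument, and minimisation a common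
  bound for its finitely many premises.\<close>

lemma accepted_complete:
  "eval {} c n = Some y \<Longrightarrow> \<exists>s\<ge>B. accepted s \<and> stage_prog s = encode c \<and> stage_in s = n \<and> stage_out s = y"
proof (induction c arbitrary: n y B)
  case (Tuple f g)
  then obtain a b where ab: "eval {} f n = Some a" "eval {} g n = Some b" "y = prod_encode (a, b)"
    by (auto simp: bind_eq_Some_conv)
  obtain i where i: "accepted i" "stage_prog i = encode f" "stage_in i = n" "stage_out i = a"
    using Tuple.IH(1)[OF ab(1)] by blast
  obtain j where j: "accepted j" "stage_prog j = encode g" "stage_in j = n" "stage_out j = b"
    using Tuple.IH(2)[OF ab(2)] by blast
  obtain s where s: "s \<ge> max B (Suc (max i j))" "stage_prog s = encode (Tuple f g)"
    "stage_in s = n" "stage_out s = y" using stage_exists by blast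
  have "i < s" "j < s" using s(1) by auto
  then have "accepted s" using i j
    unfolding accepted_Tuple[OF s(2)] s(3,4) ab(3) prod_encode_inverse fst_conv snd_conv by blast
  then show ?case using s by auto
next
  case (Compose f g)
  then obtain a where a: "eval {} g n = Some a" "eval {} f a = Some y"
    by (auto simp: bind_eq_Some_conv)
  obtain i where i: "accepted i" "stage_prog i = encode g" "stage_in i = n" "stage_out i = a"
    using Compose.IH(2)[OF a(1)] by blast
  obtain j where j: "accepted j" "stage_prog j = encode f" "stage_in j = a" "stage_out j = y"
    using Compose.IH(1)[OF a(2)] by blast
  obtain s where s: "s \<ge> max B (Suc (max i j))" "stage_prog s = encode (Compose f g)"
    "stage_in s = n" "stage_out s = y" using stage_exists by blast
  have "i < s" "j < s" using s(1) by auto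
  then have "accepted s" using i j unfolding accepted_Compose[OF s(2)] s(3,4) by blast
  then show ?case using s by auto
next
  case (PrimRec f g)
  obtain a m where n: "n = prod_encode (a, m)" by (metis prod_decode_inverse surj_pair)
  have "\<exists>s\<ge>B. accepted s \<and> stage_prog s = encode (PrimRec f g) \<and> stage_in s = prod_encode (a, m) \<and>
      stage_out s = y"
    if "eval {} (PrimRec f g) (prod_encode (a, m)) = Some y" for y B
    using that
  proof (induction m arbitrary: y B)
    case 0
    then have "eval {} f a = Some y" by simp
    then obtain i where i: "accepted i" "stage_prog i = encode f" "stage_in i = a" "stage_out i = y"
      using PrimRec.IH(1) by blast
    obtain s where s: "s \<ge> max B (Suc i)" "stage_prog s = encode (PrimRec f g)"
      "stage_in s = prod_encode (a, 0)" "stage_out s = y" using stage_exists by blast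
    have "i < s" using s(1) by auto
    then have "accepted s" using i unfolding accepted_PrimRec[OF s(2,3)] s(4) nat.case by blast
    then show ?case using s by auto
  next
    case (Suc m)
    then obtain v where v: "eval {} (PrimRec f g) (prod_encode (a, m)) = Some v"
      "eval {} g (prod_encode (a, prod_encode (m, v))) = Some y"
      by (auto simp: bind_eq_Some_conv)
    obtain i where i: "accepted i" "stage_prog i = encode (PrimRec f g)"
      "stage_in i = prod_encode (a, m)" "stage_out i = v"
      using Suc.IH[OF v(1)] by blast
    obtain j where j: "accepted j" "stage_prog j = encode g"
      "stage_in j = prod_encode (a, prod_encode (m, v))" "stage_out j = y"
      using PrimRec.IH(2)[OF v(2)] by blast
    obtain s where s: "s \<ge> max B (Suc (max i j))" "stage_prog s = encode (PrimRec f g)"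
      "stage_in s = prod_encode (a, Suc m)" "stage_out s = y" using stage_exists by blast
    have "i < s" "j < s" using s(1) by auto
    then have "accepted s" using i j unfolding accepted_PrimRec[OF s(2,3)] s(4) nat.case by blast
    then show ?case using s by auto
  qed
  then show ?case using PrimRec.prems n by blast
next
  case (Minimise f)
  let ?P = "\<lambda>m. eval {} f (prod_encode (n, m)) = Some 0 \<and>
    (\<forall>k<m. \<exists>v>0. eval {} f (prod_encode (n, k)) = Some v)"
  have ex: "\<exists>m. ?P m" and y: "y = (LEAST m. eval {} f (prod_encode (n, m)) = Some 0)"
    using Minimise.prems by (auto split: if_splits)
  from ex obtain m where m: "?P m" by blast
  have "(LEAST m. eval {} f (prod_encode (n, m)) = Some 0) = m"
    using m by (intro Least_equality) (auto simp: not_less[symmetric])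
  with m y have y: "?P y" by simp
  then obtain i where i: "accepted i" "stage_prog i = encode f"
    "stage_in i = prod_encode (n, y)" "stage_out i = 0" using Minimise.IH by blast
  have "\<forall>k<y. \<exists>i. accepted i \<and> stage_prog i = encode f \<and> stage_in i = prod_encode (n, k) \<and> 0 < stage_out i"
    using y Minimise.IH by metis
  from bounded_witnesses[OF this] obtain N where N: "\<forall>k<y. \<exists>i<N. accepted i \<and> stage_prog i = encode f \<and>
      stage_in i = prod_encode (n, k) \<and> 0 < stage_out i" by blast
  obtain s where s: "s \<ge> max B (max N (Suc i))" "stage_prog s = encode (Minimise f)"
    "stage_in s = n" "stage_out s = y" using stage_exists by blast
  have "i < s" "N \<le> s" using s(1) by auto
  then have "accepted s" using i N unfolding accepted_Minimise[OF s(2)] s(3,4) by (meson less_le_trans)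
  then show ?case using s by auto
next
  case Zero
  then show ?case using stage_exists[of B "encode Zero" n y] accepted_atomic by fastforce
next
  case Successor
  then show ?case using stage_exists[of B "encode Successor" n y] accepted_atomic by fastforce
next
  case First
  then show ?case using stage_exists[of B "encode First" n y] accepted_atomic by fastforce
next
  case Second
  then show ?case using stage_exists[of B "encode Second" n y] accepted_atomic by fastforce
next
  case Oracle
  then show ?case using stage_exists[of B "encode Oracle" n y] accepted_atomic by fastforce
qed

lemma W_iff: "n \<in> W e \<longleftrightarrow> (\<exists>s. accepted s \<and> stage_prog s = e \<and> stage_in s = n)"
proof
  have e: "encode (inv encode e) = e" by (simp add: surj_encode surj_f_inv_f)
  show "\<exists>s. accepted s \<and> stage_prog s = e \<and> stage_in s = n" if "n \<in> W e"
    using that accepted_complete[of "inv encode e" n _ 0] e unfolding W_def by fastforce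
  show "n \<in> W e" if "\<exists>s. accepted s \<and> stage_prog s = e \<and> stage_in s = n"
    using that accepted_sound[of _ "inv encode e"] e unfolding W_def by fastforce
qed

text \<open>Late reappearances let a requirement act on an element after its first enumeration,
  which is an event of another kind.\<close>

lemma accepted_again:
  assumes "n \<in> W e"
  shows "\<exists>s\<ge>B. accepted s \<and> stage_prog s = e \<and> stage_in s = n"
proof -
  have e: "encode (inv encode e) = e" by (simp add: surj_encode surj_f_inv_f)
  show ?thesis using assms accepted_complete[of "inv encode e" n _ B] e unfolding W_def by fastforce
qed

section \<open>The dumping construction\<close>

text \<open>A step function, equal to \<open>20 * 16 ^ i\<close> for
  \<open>16 ^ i < n \<le> 16 ^ (i + 1)\<close>. Being constant on such a block, it lets the dumps of
  one block respect each other's survivors; being 20 rather than 16 times the lower end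
  \<open>T\<close>, it also protects hits of weight between \<open>16 * T\<close> and
  \<open>20 * T\<close>. The bound \<open>i < n\<close> loses nothing and keeps the count
  bounded.\<close>

definition guard :: "nat \<Rightarrow> nat" where
  "guard n = 20 * 16 ^ card {i. i < n \<and> 16 ^ (i + 1) < n}"

lemma guard_le: "n \<le> 16 ^ (i + 1) \<Longrightarrow> guard n \<le> 20 * 16 ^ i"
proof -
  assume n: "n \<le> 16 ^ (i + 1)"
  have "{i. i < n \<and> 16 ^ (i + 1) < n} \<subseteq> {..<i}"
  proof
    fix j assume "j \<in> {i. i < n \<and> 16 ^ (i + 1) < n}"
    then have "(16::nat) ^ (j + 1) < 16 ^ (i + 1)" using n less_le_trans by blast
    then have "j + 1 < i + 1" by (rule power_less_imp_less_exp[rotated]) simp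
    then show "j \<in> {..<i}" by simp
  qed
  then have "card {i. i < n \<and> 16 ^ (i + 1) < n} \<le> i"
    using card_mono[of "{..<i}"] by fastforce
  then show ?thesis by (simp add: guard_def)
qed

lemma guard_ge: "16 ^ i < n \<Longrightarrow> 20 * 16 ^ i \<le> guard n"
proof -
  assume n: "16 ^ i < n"
  have "{..<i} \<subseteq> {i. i < n \<and> 16 ^ (i + 1) < n}"
  proof
    fix j assume "j \<in> {..<i}"
    then have "j < i" by simp
    moreover have "(16::nat) ^ (j + 1) \<le> 16 ^ i" by (rule power_increasing) (use \<open>j < i\<close> in auto)
    moreover have "i < 16 ^ i" by (rule less_exp[THEN less_le_trans]) (simp add: power_mono)
    ultimately show "j \<in> {i. i < n \<and> 16 ^ (i + 1) < n}" using n by simp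
  qed
  then have "card {..<i} \<le> card {i. i < n \<and> 16 ^ (i + 1) < n}" by (intro card_mono) auto
  then show ?thesis by (simp add: guard_def)
qed

lemma guard_mono: "m \<le> n \<Longrightarrow> guard m \<le> guard n"
  unfolding guard_def by (auto intro!: power_increasing card_mono)

text \<open>Hence an event is always among those protected from later events of at least its own
  weight.\<close>

lemma le_guard: "n \<le> guard n"
proof -
  have "n < 2 ^ n" by (rule less_exp)
  also have "(2::nat) ^ n \<le> 16 ^ n" by (rule power_mono) simp_all
  finally have "\<exists>i. n \<le> 16 ^ (i + 1)" by (intro exI[of _ n]) simp
  then obtain i where i: "n \<le> 16 ^ (i + 1)" "\<forall>j<i. \<not> n \<le> 16 ^ (j + 1)"
    using exists_least_iff[of "\<lambda>i. n \<le> 16 ^ (i + 1)"] by blast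
  show ?thesis
  proof (cases i)
    case 0
    then have "n \<le> 20 * 1" using i by simp
    also have "20 * 1 \<le> guard n" unfolding guard_def by (intro mult_le_mono) simp_all
    finally show ?thesis .
  next
    case (Suc j)
    then have "16 ^ i < n" using i(2)[rule_format, of j] by simp
    then show ?thesis using guard_ge[of i n] i(1) by simp
  qed
qed

text \<open>If every bit set in \<open>n\<close> were set in \<open>m\<close>, then
  \<open>n \<le> m\<close>. The induction removes the lowest bit.\<close>

lemma ex_bit_increased: "m < n \<Longrightarrow> \<exists>j. odd (n div 2 ^ j) \<and> even (m div 2 ^ j)" for m n :: nat
proof (induction n arbitrary: m rule: less_induct)
  case (less n)
  show ?case
  proof (cases "m div 2 < n div 2")
    case True
    then obtain j where "odd (n div 2 div 2 ^ j)" "even (m div 2 div 2 ^ j)"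
      using less.IH[of "n div 2" "m div 2"] less.prems by auto
    then show ?thesis by (intro exI[of _ "Suc j"]) (simp add: div_mult2_eq)
  next
    case False
    then have "odd n" "even m" using less.prems by presburger+
    then show ?thesis by (intro exI[of _ 0]) simp
  qed
qed

text \<open>\<open>wt t\<close> is 0 if there is no event at stage \<open>t\<close>, and otherwise its weight plus one; so
  \<open>event k t\<close> below says that there is one of weight less than \<open>k\<close>.\<close>

locale event_system =
  fixes wt hit :: "nat \<Rightarrow> nat"
  assumes hit_le: "0 < wt t \<Longrightarrow> hit t \<le> t"
    and finite_events: "finite {t. 0 < wt t \<and> wt t \<le> k}"
    and card_events: "card {t. 0 < wt t \<and> wt t \<le> k} \<le> 2 ^ (k + 1)"
    and ex_event: "\<exists>t\<ge>b. 0 < wt t"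
begin

section \<open>Event counts and the dumped set\<close>

definition event :: "nat \<Rightarrow> nat \<Rightarrow> bool" where
  "event k t \<longleftrightarrow> 0 < wt t \<and> wt t \<le> k"

definition cnt :: "nat \<Rightarrow> nat \<Rightarrow> nat" where
  "cnt k t = card {s. s < t \<and> event k s}"

definition total :: "nat \<Rightarrow> nat" where
  "total k = card {s. event k s}"

definition protected :: "nat \<Rightarrow> nat \<Rightarrow> nat \<Rightarrow> bool" where
  "protected k s y \<longleftrightarrow> (\<exists>i<s. event (guard k) i \<and> (y = i \<or> y = hit i))"

text \<open>A decidable approximation to \<open>A\<close>, increasing in \<open>t\<close>, which the
  programs consult in place of \<open>A\<close>.\<close>

definition dumped :: "nat \<Rightarrow> nat \<Rightarrow> bool" where
  "dumped t y \<longleftrightarrow> (\<exists>s<t. 0 < wt s \<and> y < s \<and> \<not> protected (wt s) s y)"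

definition A :: "nat set" where
  "A = {y. \<exists>t. dumped t y}"

lemma finite_event: "finite {s. event k s}"
  using finite_events[of k] by (simp add: event_def)

lemma total_le: "total k \<le> 2 ^ (k + 1)"
  using card_events[of k] by (simp add: event_def total_def)

lemma cnt_mono: "s \<le> t \<Longrightarrow> cnt k s \<le> cnt k t"
  unfolding cnt_def by (intro card_mono) auto

lemma cnt_le_total: "cnt k t \<le> total k"
  unfolding cnt_def total_def by (intro card_mono finite_event) auto

lemma cnt_Suc: "cnt k (Suc t) = (if event k t then Suc (cnt k t) else cnt k t)"
proof -
  have "{s. s < Suc t \<and> event k s} =
      (if event k t then insert t {s. s < t \<and> event k s} else {s. s < t \<and> event k s})"
    by (auto simp: less_Suc_eq)
  then show ?thesis by (simp add: cnt_def)
qed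

lemma ex_cnt_total: "\<exists>t0. \<forall>t\<ge>t0. cnt k t = total k"
proof -
  obtain b where b: "\<forall>s\<in>{s. event k s}. s < b"
    using finite_event finite_nat_set_iff_bounded by blast
  then have "{s. s < t \<and> event k s} = {s. event k s}" if "t \<ge> b" for t
    using that by auto
  then show ?thesis by (intro exI[of _ b]) (simp add: cnt_def total_def)
qed

lemma no_event_after: "cnt k t = total k \<Longrightarrow> t \<le> s \<Longrightarrow> \<not> event k s"
  using cnt_Suc[of k s] cnt_le_total[of k "Suc s"] cnt_mono[of t s k] by auto

lemma protected_mono:
  assumes "protected k s y" "guard k \<le> guard l" "s \<le> t"
  shows "protected l t y"
proof -
  obtain i where "i < s" "event (guard k) i" "y = i \<or> y = hit i"
    using assms(1) unfolding protected_def by blast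
  moreover have "event (guard l) i" "i < t" using calculation assms(2,3) by (simp_all add: event_def)
  ultimately show ?thesis unfolding protected_def by blast
qed

text \<open>What survives the dump at \<open>t\<close> is protected at \<open>t\<close>, and the
  guards of all later events are at least as large, so the protection is never lost.\<close>

lemma frozen:
  assumes t: "0 < wt t" and later: "\<And>s. t < s \<Longrightarrow> 0 < wt s \<Longrightarrow> guard (wt t) \<le> guard (wt s)"
    and y: "y \<in> A" "y \<le> t"
  shows "dumped (Suc t) y"
proof (rule ccontr)
  assume nd: "\<not> dumped (Suc t) y"
  obtain s where s: "0 < wt s" "y < s" "\<not> protected (wt s) s y"
    using y(1) unfolding A_def dumped_def by blast
  with nd have ts: "t < s" unfolding dumped_def using not_less_eq by blast
  have g: "guard (wt t) \<le> guard (wt s)" using later ts s(1) .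
  show False
  proof (cases "y = t")
    case True
    \<comment> \<open>The dump at \<open>t\<close> does not reach \<open>t\<close> itself; as the
      stage of an event, \<open>t\<close> is protected from the later ones.\<close>
    have "event (guard (wt s)) t" using t g le_guard[of "wt t"] by (simp add: event_def)
    then show False using s(3) ts True unfolding protected_def by blast
  next
    case False
    then have "protected (wt t) t y" using nd t y(2) unfolding dumped_def
      by (metis le_neq_implies_less lessI)
    then have "protected (wt s) s y" using g ts by (auto intro: protected_mono)
    then show False using s(3) by simp
  qed
qed

text \<open>Among the events from \<open>b\<close> on, one of least weight is protected from all
  later events, so its stage stays outside \<open>A\<close>.\<close>

lemma coinfinite: "\<exists>t\<ge>b. t \<notin> A"
proof -
  define P where "P = (\<lambda>w. \<exists>t\<ge>b. wt t = w \<and> 0 < w)"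
  have "\<exists>w. P w" using ex_event[of b] unfolding P_def by blast
  then obtain w where w: "P w" "\<forall>v<w. \<not> P v"
    using exists_least_iff[of P] by blast
  from w(1) obtain t where t: "t \<ge> b" "wt t = w" "0 < w" unfolding P_def by blast
  have "t \<notin> A"
  proof
    assume "t \<in> A"
    then obtain s where s: "0 < wt s" "t < s" "\<not> protected (wt s) s t"
      unfolding A_def dumped_def by blast
    have "w \<le> wt s" using w(2) s t(1) unfolding P_def by (metis le_trans less_imp_le not_less)
    then have "event (guard (wt s)) t"
      using t le_guard[of "wt s"] unfolding event_def by linarith
    then show False using s unfolding protected_def by blast
  qed
  with t show ?thesis by blast
qed

definition protectable :: "nat \<Rightarrow> nat set" where
  "protectable k = {y. \<exists>i. event (guard k) i \<and> (y = i \<or> y = hit i)}"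

text \<open>Each event contributes its stage and its hit, hence twice the bound
  \<open>2 ^ (guard k + 1)\<close>.\<close>

lemma protectable: "finite (protectable k)" "card (protectable k) \<le> 2 ^ (guard k + 2)"
proof -
  have eq: "protectable k = {i. event (guard k) i} \<union> hit ` {i. event (guard k) i}"
    unfolding protectable_def by auto
  show "finite (protectable k)" unfolding eq using finite_event by blast
  have "card (protectable k) \<le> total (guard k) + total (guard k)"
    unfolding eq total_def
    by (rule order_trans[OF card_Un_le add_mono[OF order_refl card_image_le[OF finite_event]]])
  also have "\<dots> \<le> 2 ^ (guard k + 2)" using total_le[of "guard k"] by simp
  finally show "card (protectable k) \<le> 2 ^ (guard k + 2)" .
qed

lemma protected_protectable: "protected w s y \<Longrightarrow> w \<le> k \<Longrightarrow> y \<in> protectable k"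
  unfolding protected_def protectable_def event_def using guard_mono[of w k] by (auto intro: le_trans)

text \<open>An event of weight below \<open>k\<close> spares only elements of
  \<open>protectable k\<close> below its stage. Many survivors below \<open>t\<close> therefore
  certify, with oracle \<open>A\<close>, that such events are over.\<close>

lemma no_event_after_many:
  assumes "card {y. y < t \<and> y \<notin> A} > 2 ^ (guard k + 2)" "t \<le> s"
  shows "\<not> event k s"
proof
  assume e: "event k s"
  have "{y. y < t \<and> y \<notin> A} \<subseteq> protectable k"
  proof
    fix y assume "y \<in> {y. y < t \<and> y \<notin> A}"
    then have "y < s" "\<not> dumped (Suc s) y" using assms(2) unfolding A_def by auto
    then have "protected (wt s) s y" using e unfolding dumped_def event_def by auto
    then show "y \<in> protectable k" using protected_protectable e unfolding event_def by blast
  qed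
  then have "card {y. y < t \<and> y \<notin> A} \<le> card (protectable k)" by (intro card_mono protectable)
  with protectable(2)[of k] assms(1) show False by simp
qed

section \<open>Programs that watch one bit of an event counter\<close>

text \<open>The successor tells a clock that has started from one that has not, which shows 0. The
  threshold \<open>v\<close> will be such that no event of weight below \<open>T\<close> happens
  once it is reached.\<close>

definition clock :: "nat \<Rightarrow> nat \<Rightarrow> nat \<Rightarrow> nat \<Rightarrow> nat" where
  "clock T k v t = (if v \<le> cnt k t then Suc (cnt (16 * T) t) else 0)"

definition ticking :: "nat \<Rightarrow> nat \<Rightarrow> nat \<Rightarrow> nat \<Rightarrow> nat \<Rightarrow> nat \<Rightarrow> bool" where
  "ticking T k v j z t \<longleftrightarrow> z \<le> t \<and> odd (clock T k v t div 2 ^ j)"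

text \<open>The clock at \<open>x\<close> is below its final value, because it has not started or an
  event is still to come; so some bit \<open>j\<close> of the final value is unset at
  \<open>x\<close>. A program that has to wait stops just after the clock changes, hence just after
  an event of weight below \<open>16 * T\<close>. All later events have weight at least
  \<open>T\<close>, so \<open>frozen\<close> makes the approximation final up to that event.\<close>

theorem counter_programs:
  assumes T: "T = 16 ^ i" and k: "k \<le> 16 * T" and v: "v \<le> total k"
    and quiet: "\<And>t. v \<le> cnt k t \<Longrightarrow> \<not> event T t"
    and x: "cnt k x < v \<or> (\<exists>t\<ge>x. event (16 * T) t)"
  obtains j where "2 ^ j \<le> Suc (total (16 * T))"
    and "\<And>z. \<exists>t. ticking T k v j z t"
    and "\<And>z t. t = (LEAST t. ticking T k v j z t) \<Longrightarrow> z < t \<Longrightarrow> dumped t z \<longleftrightarrow> z \<in> A"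
    and "x < (LEAST t. ticking T k v j x t)"
proof -
  let ?N = "Suc (total (16 * T))"
  obtain t1 where t1: "\<forall>t\<ge>t1. cnt k t = total k" using ex_cnt_total by blast
  obtain t2 where t2: "\<forall>t\<ge>t2. cnt (16 * T) t = total (16 * T)" using ex_cnt_total by blast
  have lim: "clock T k v t = ?N" if "t \<ge> max t1 t2" for t
    using that t1 t2 v by (simp add: clock_def)
  have "clock T k v x < ?N"
  proof (cases "cnt k x < v")
    case False
    then obtain t where t: "t \<ge> x" "event (16 * T) t" using x by blast
    then have "cnt (16 * T) x < cnt (16 * T) (Suc t)"
      using cnt_Suc[of "16 * T" t] cnt_mono[of x t "16 * T"] by simp
    then show ?thesis using cnt_le_total[of "16 * T" "Suc t"] by (simp add: clock_def)
  qed (simp add: clock_def)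
  then obtain j where j: "odd (?N div 2 ^ j)" "even (clock T k v x div 2 ^ j)"
    using ex_bit_increased by blast
  have "?N div 2 ^ j \<noteq> 0" using j(1) by (metis even_zero)
  then have 1: "2 ^ j \<le> ?N" by (simp add: div_eq_0_iff)
  have 2: "\<exists>t. ticking T k v j z t" for z
  proof -
    have "ticking T k v j z (max z (max t1 t2))"
      using lim[of "max z (max t1 t2)"] j(1) unfolding ticking_def by simp
    then show ?thesis by blast
  qed
  have least: "ticking T k v j z (LEAST t. ticking T k v j z t)" for z
    using 2 by (rule LeastI_ex)
  have 3: "dumped t z \<longleftrightarrow> z \<in> A" if t: "t = (LEAST t. ticking T k v j z t)" and "z < t" for z t
  proof
    assume zA: "z \<in> A"
    obtain u where u: "t = Suc u" "z \<le> u" using \<open>z < t\<close> by (cases t) auto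
    have on: "ticking T k v j z t" using least t by simp
    have off: "\<not> ticking T k v j z u" using not_less_Least[of u "ticking T k v j z"] t u(1) by simp
    have "clock T k v u \<noteq> clock T k v t" using on off u(2) unfolding ticking_def by auto
    then have jump: "\<not> v \<le> cnt k u \<and> v \<le> cnt k (Suc u) \<or> event (16 * T) u"
      using cnt_mono[of u "Suc u" k] unfolding clock_def u(1) cnt_Suc[of "16 * T"]
      by (auto split: if_splits)
    \<comment> \<open>As \<open>k \<le> 16 * T\<close>, the event that starts the clock also has
      weight below \<open>16 * T\<close>.\<close>
    then have eu: "event (16 * T) u"
      using cnt_Suc[of k u] k unfolding event_def by (auto split: if_splits)
    have started: "v \<le> cnt k (Suc u)"
      using on unfolding ticking_def clock_def u(1) by (auto split: if_splits)
    show "dumped t z" unfolding u(1)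
    proof (rule frozen[OF _ _ zA u(2)])
      show "0 < wt u" using eu by (simp add: event_def)
      fix s assume s: "u < s" "0 < wt s"
      have "v \<le> cnt k s" using started cnt_mono[of "Suc u" s k] s(1) by simp
      then have "16 ^ i < wt s" using quiet[of s] s(2) T by (simp add: event_def not_le)
      then have "20 * 16 ^ i \<le> guard (wt s)" by (rule guard_ge)
      moreover have "guard (wt u) \<le> 20 * 16 ^ i"
        using eu T by (intro guard_le) (simp add: event_def)
      ultimately show "guard (wt u) \<le> guard (wt s)" by simp
    qed
  qed (auto simp: A_def)
  have 4: "x < (LEAST t. ticking T k v j x t)"
    using least[of x] j(2) unfolding ticking_def by (metis le_neq_implies_less)
  show thesis using that 1 2 3 4 by blast
qed

section \<open>Programs for short rounds\<close>

text \<open>A round is the time since the last event of weight below \<open>16 * T\<close>. The case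
  \<open>u = s\<close> excludes that event itself from the count.\<close>

definition round_cnt :: "nat \<Rightarrow> nat \<Rightarrow> nat" where
  "round_cnt T t = card {s. s < t \<and> event (20 * T) s \<and> (\<forall>u<t. s \<le> u \<longrightarrow> \<not> event (16 * T) u)}"

definition late :: "nat \<Rightarrow> nat \<Rightarrow> nat \<Rightarrow> nat \<Rightarrow> nat \<Rightarrow> bool" where
  "late T q m z t \<longleftrightarrow> z < t \<and> q \<le> cnt T t \<and> m < round_cnt T t"

definition hit_before :: "nat \<Rightarrow> nat \<Rightarrow> nat \<Rightarrow> bool" where
  "hit_before T z t \<longleftrightarrow> (\<exists>s<t. event (20 * T) s \<and> hit s = z)"

text \<open>Here \<open>m\<close> counts the events of the last round before \<open>t0\<close>.
  After \<open>Q\<close> the count is never reset, so it exceeds \<open>m\<close> exactly when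
  \<open>t0\<close> has passed, and then \<open>x\<close> has been hit. A number hit with weight
  below \<open>20 * T\<close> is safe once the events of weight below \<open>T\<close> are over, as
  all later guards are at least \<open>20 * T\<close>; so the answer is right even if the search
  stops in an earlier round.\<close>

theorem short_round_programs:
  assumes T: "T = 16 ^ i" and x: "event (20 * T) t0" "hit t0 = x"
    and Q: "event (16 * T) Q" "Q < x" "\<And>u. Q < u \<Longrightarrow> \<not> event (16 * T) u"
    and L: "0 < L" "L * (total (20 * T) div L) \<le> cnt (20 * T) Q"
  obtains m where "m < L"
    and "\<And>z. \<exists>t. late T (total T) m z t"
    and "\<And>z t. t = (LEAST t. late T (total T) m z t) \<Longrightarrow> hit_before T z t \<Longrightarrow> dumped t z \<longleftrightarrow> z \<in> A"
    and "hit_before T x (LEAST t. late T (total T) m x t)"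
proof -
  have xt0: "x \<le> t0" using hit_le[of t0] x by (simp add: event_def)
  have rc: "round_cnt T t = card {s. Q < s \<and> s < t \<and> event (20 * T) s}" if "Q < t" for t
  proof -
    have "{s. s < t \<and> event (20 * T) s \<and> (\<forall>u<t. s \<le> u \<longrightarrow> \<not> event (16 * T) u)} =
        {s. Q < s \<and> s < t \<and> event (20 * T) s}"
      using Q(1,3) that by (auto simp: not_le[symmetric])
    then show ?thesis by (simp add: round_cnt_def)
  qed
  define m where "m = round_cnt T t0"
  have m: "m = card {s. Q < s \<and> s < t0 \<and> event (20 * T) s}"
    using rc[of t0] xt0 Q(2) by (simp add: m_def)
  have fin: "finite {s. Q < s \<and> s < t \<and> event (20 * T) s}" for t by (rule finite_subset[of _ "{..<t}"]) auto
  have above: "m < round_cnt T t \<longleftrightarrow> t0 < t" if "Q < t" for t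
  proof
    assume "t0 < t"
    then have "insert t0 {s. Q < s \<and> s < t0 \<and> event (20 * T) s} \<subseteq> {s. Q < s \<and> s < t \<and> event (20 * T) s}"
      using x Q(2) xt0 by auto
    then have "card (insert t0 {s. Q < s \<and> s < t0 \<and> event (20 * T) s}) \<le> round_cnt T t"
      unfolding rc[OF that] by (intro card_mono fin)
    then show "m < round_cnt T t" using fin m by simp
  next
    assume less: "m < round_cnt T t"
    show "t0 < t"
    proof (rule ccontr)
      assume "\<not> t0 < t"
      then have "round_cnt T t \<le> m" unfolding rc[OF that] m by (intro card_mono fin) auto
      with less show False by simp
    qed
  qed
  have "m < L"
  proof -
    \<comment> \<open>At least \<open>L * (total (20 * T) div L)\<close> events lie in
      \<open>?B\<close>, so \<open>?C\<close> and \<open>t0\<close> fit into the remainder, which is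
      below \<open>L\<close>.\<close>
    let ?B = "{s. s < Q \<and> event (20 * T) s}" and ?C = "{s. Q < s \<and> s < t0 \<and> event (20 * T) s}"
    have "card (insert t0 (?B \<union> ?C)) = Suc (card ?B + card ?C)"
      using fin[of t0] Q(2) xt0 by (subst card_insert_disjoint) (auto intro!: card_Un_disjoint)
    moreover have "card (insert t0 (?B \<union> ?C)) \<le> total (20 * T)"
      unfolding total_def using x by (intro card_mono finite_event) auto
    ultimately have "Suc (cnt (20 * T) Q + m) \<le> total (20 * T)" by (simp add: cnt_def m)
    then have "Suc (L * (total (20 * T) div L) + m) \<le> total (20 * T)" using L(2) by simp
    also have "total (20 * T) < L * (total (20 * T) div L) + L"
      using L(1) by (metis add_less_cancel_left mod_less_divisor mult_div_mod_eq)
    finally show ?thesis by simp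
  qed
  obtain t1 where t1: "\<forall>t\<ge>t1. cnt T t = total T" using ex_cnt_total by blast
  have 2: "\<exists>t. late T (total T) m z t" for z
  proof -
    have "late T (total T) m z (Suc (max z (max t0 t1)))"
      using t1 above[of "Suc (max z (max t0 t1))"] Q(2) xt0
      by (simp add: late_def less_Suc_eq_le le_max_iff_disj)
    then show ?thesis by blast
  qed
  have least: "late T (total T) m z (LEAST t. late T (total T) m z t)" for z
    using 2 by (rule LeastI_ex)
  have 3: "dumped t z \<longleftrightarrow> z \<in> A"
    if t: "t = (LEAST t. late T (total T) m z t)" and hb: "hit_before T z t" for z t
  proof
    assume "z \<in> A"
    then obtain s where s: "0 < wt s" "z < s" "\<not> protected (wt s) s z"
      unfolding A_def dumped_def by blast
    have "s < t"
    proof (rule ccontr)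
      assume "\<not> s < t"
      obtain s' where s': "s' < t" "event (20 * T) s'" "hit s' = z"
        using hb unfolding hit_before_def by blast
      have "cnt T t = total T"
        using least[of z] cnt_le_total[of T t] t unfolding late_def by (simp add: le_antisym)
      then have "\<not> event T s" using no_event_after \<open>\<not> s < t\<close> by simp
      then have "20 * 16 ^ i \<le> guard (wt s)" using s(1) T by (intro guard_ge) (simp add: event_def)
      then have "protected (wt s) s z"
        unfolding protected_def using s' \<open>\<not> s < t\<close> T
        by (intro exI[of _ s']) (auto simp: event_def)
      with s(3) show False ..
    qed
    then show "dumped t z" using s unfolding dumped_def by blast
  qed (auto simp: A_def)
  have 4: "hit_before T x (LEAST t. late T (total T) m x t)"
  proof -
    let ?t = "LEAST t. late T (total T) m x t"
    have "x < ?t" "m < round_cnt T ?t" using least[of x] unfolding late_def by auto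
    then have "t0 < ?t" using above[of ?t] Q(2) by simp
    then show ?thesis using x unfolding hit_before_def by blast
  qed
  show thesis using that \<open>m < L\<close> 2 3 4 by blast
qed

end

section \<open>Computability of the construction\<close>

lemma computable_in_guard:
  "computable_in X f \<Longrightarrow> computable_in X (\<lambda>x. guard (f x))"
proof (rule computable_in_comp[where f = guard])
  show "computable_in X guard" unfolding guard_def [abs_def] by (intro computable_in_intros)
qed

locale computable_event_system = event_system +
  assumes computable_wt: "computable_in X wt" and computable_hit: "computable_in X hit"
begin

lemmas computable_in_wt = computable_in_comp[OF computable_wt]
lemmas computable_in_hit = computable_in_comp[OF computable_hit]

lemma computable_in_event:
  "computable_in X k \<Longrightarrow> computable_in X t \<Longrightarrow> computable_in X (\<lambda>x. event (k x) (t x))"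
  unfolding event_def by (intro computable_in_intros computable_in_wt)

lemma computable_in_cnt [THEN computable_in_comp2]:
  "computable_in X (\<lambda>u. cnt (fst u) (snd u))"
  unfolding cnt_def by (intro computable_in_event computable_in_intros)

lemma computable_in_dumped [THEN computable_in_comp2]:
  "computable_in X (\<lambda>u. dumped (fst u) (snd u))"
  unfolding dumped_def protected_def
  by (intro computable_in_event computable_in_intros computable_in_wt computable_in_hit computable_in_guard)

lemma computable_in_ticking:
  assumes "computable_in X T" "computable_in X k" "computable_in X v" "computable_in X j"
    "computable_in X z" "computable_in X t"
  shows "computable_in X (\<lambda>x. ticking (T x) (k x) (v x) (j x) (z x) (t x))"
  unfolding ticking_def clock_def by (intro computable_in_cnt computable_in_intros assms)

lemma computable_in_round_cnt [THEN computable_in_comp2]: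
  "computable_in X (\<lambda>u. round_cnt (fst u) (snd u))"
proof -
  have "(\<forall>u<t. s \<le> u \<longrightarrow> \<not> event (16 * T) u) \<longleftrightarrow> \<not> (\<exists>u<t. s \<le> u \<and> event (16 * T) u)" for t s T
    by blast
  then show ?thesis unfolding round_cnt_def
    by (simp only:) (intro computable_in_event computable_in_intros)
qed

lemma computable_in_late:
  assumes "computable_in X T" "computable_in X q" "computable_in X m"
    "computable_in X z" "computable_in X t"
  shows "computable_in X (\<lambda>x. late (T x) (q x) (m x) (z x) (t x))"
  unfolding late_def by (intro computable_in_cnt computable_in_round_cnt computable_in_intros assms)

lemma computable_in_hit_before:
  assumes "computable_in X T" "computable_in X z" "computable_in X t"
  shows "computable_in X (\<lambda>x. hit_before (T x) (z x) (t x))"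
proof -
  have "computable_in X (\<lambda>u. hit_before (fst u) (fst (snd u)) (snd (snd u)))"
    unfolding hit_before_def by (intro computable_in_event computable_in_hit computable_in_intros)
  from computable_in_comp[OF this computable_in_Pair[OF assms(1) computable_in_Pair[OF assms(2,3)]]]
  show ?thesis by simp
qed

lemma re_A: "re A"
proof -
  have "computable_in {} (\<lambda>u. dumped (snd u) (fst u))"
    by (intro computable_in_dumped computable_in_intros)
  from computable_in_search[of _ "\<lambda>x t. dumped t x", OF this computable_in_const[of _ "0::nat"]]
  obtain c where "\<forall>x. eval {} c x = (if \<exists>t. dumped t x then Some 0 else None)"
    by (auto cong: if_cong)
  then have "A = dom (eval {} c)" unfolding A_def dom_def by auto
  also have "c = inv encode (encode c)" by (simp add: inj_encode)
  finally show ?thesis unfolding re_def W_def by metis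
qed

lemma infinite_compl_A: "infinite (- A)"
  unfolding infinite_nat_iff_unbounded_le using coinfinite by auto

end

section \<open>Strings as numbers\<close>

text \<open>The strings of length \<open>l\<close> have the numbers from \<open>2 ^ l - 1\<close> to
  \<open>2 ^ (l + 1) - 2\<close>, so the length is the integer part of the binary logarithm of
  \<open>n + 1\<close>.\<close>

definition str_len :: "nat \<Rightarrow> nat" where
  "str_len n = card {j. j < n \<and> 2 ^ (j + 1) \<le> n + 1}"

lemma computable_in_str_len:
  "computable_in X f \<Longrightarrow> computable_in X (\<lambda>x. str_len (f x))"
proof (rule computable_in_comp[where f = str_len])
  show "computable_in X str_len" unfolding str_len_def [abs_def] by (intro computable_in_intros)
qed

lemma nat_of_str_bounds: "2 ^ length p \<le> nat_of_str p + 1" "nat_of_str p + 1 < 2 ^ (length p + 1)"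
  by (induction p rule: rev_induct) auto

lemma str_len_le: "n + 1 < 2 ^ (l + 1) \<Longrightarrow> str_len n \<le> l"
proof -
  assume n: "n + 1 < 2 ^ (l + 1)"
  have "{j. j < n \<and> 2 ^ (j + 1) \<le> n + 1} \<subseteq> {..<l}"
  proof
    fix j assume "j \<in> {j. j < n \<and> 2 ^ (j + 1) \<le> n + 1}"
    then have "(2::nat) ^ (j + 1) < 2 ^ (l + 1)" using n le_less_trans by blast
    then have "j + 1 < l + 1" by (rule power_less_imp_less_exp[rotated]) simp
    then show "j \<in> {..<l}" by simp
  qed
  then show ?thesis unfolding str_len_def using card_mono[of "{..<l}"] by fastforce
qed

lemma str_len_nat_of_str: "str_len (nat_of_str p) = length p"
proof (rule antisym)
  show "str_len (nat_of_str p) \<le> length p" using nat_of_str_bounds(2) by (rule str_len_le)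
  have "{..<length p} \<subseteq> {j. j < nat_of_str p \<and> 2 ^ (j + 1) \<le> nat_of_str p + 1}"
  proof
    fix j assume "j \<in> {..<length p}"
    then have "(2::nat) ^ (j + 1) \<le> 2 ^ length p" by (intro power_increasing) auto
    then have "2 ^ (j + 1) \<le> nat_of_str p + 1" using nat_of_str_bounds(1)[of p] by simp
    moreover have "j + 1 < 2 ^ (j + 1)" by (rule less_exp)
    ultimately show "j \<in> {j. j < nat_of_str p \<and> 2 ^ (j + 1) \<le> nat_of_str p + 1}" by simp
  qed
  then have "card {..<length p} \<le> str_len (nat_of_str p)"
    unfolding str_len_def by (intro card_mono) auto
  then show "length p \<le> str_len (nat_of_str p)" by simp
qed

lemma obtain_str: obtains p where "nat_of_str p = n" "length p = str_len n"
  using bij_nat_of_str str_len_nat_of_str by (metis bij_pointE)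

lemma str_len_le_self: "str_len n \<le> n"
  unfolding str_len_def using card_mono[of "{..<n}" "{j. j < n \<and> 2 ^ (j + 1) \<le> n + 1}"] by fastforce

section \<open>The events\<close>

definition fresh :: "nat \<Rightarrow> bool" where
  "fresh t \<longleftrightarrow> accepted t \<and> \<not> (\<exists>i<t. accepted i \<and> stage_prog i = stage_prog t \<and> stage_in i = stage_in t)"

text \<open>Here \<open>u\<close> stands for the number of a program for \<open>U\<close>. The empty
  string has number 0, and output 0 is \<open>Bot\<close>, which describes nothing.\<close>

definition describes :: "nat \<Rightarrow> nat \<Rightarrow> bool" where
  "describes u t \<longleftrightarrow> stage_prog t = u \<and> snd (prod_decode (stage_in t)) = 0 \<and> 0 < stage_out t"

text \<open>The subtraction undoes the successor in \<open>nat_of_out\<close>. Other events hit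
  their own stage, which protects nothing new.\<close>

definition hits :: "nat \<Rightarrow> nat \<Rightarrow> nat" where
  "hits u t = (if describes u t then stage_out t - 1 else t)"

text \<open>A fresh stage records a new halting computation. The second branch is the single action
  of the requirement for \<open>W e\<close>, with \<open>e = stage_prog s\<close>, on an element
  that no protection saves. Since only stages that are not fresh can act, an earlier action is
  recognised by its positive weight.\<close>

definition weight_step :: "nat \<Rightarrow> nat \<Rightarrow> (nat \<Rightarrow> nat) \<Rightarrow> nat" where
  "weight_step u s g =
    (if fresh s then
       Suc (if describes u s then str_len (fst (prod_decode (stage_in s)))
            else prod_encode (stage_prog s, stage_in s))
     else if accepted s \<and> stage_in s < s \<and> \<not> (\<exists>i<s. stage_prog i = stage_prog s \<and> \<not> fresh i \<and> 0 < g i) \<and>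
       \<not> (\<exists>i<s. 0 < g i \<and> g i \<le> guard (Suc (stage_prog s)) \<and> (stage_in s = i \<or> stage_in s = hits u i))
     then Suc (stage_prog s) else 0)"

definition weight :: "nat \<Rightarrow> nat \<Rightarrow> nat" where
  "weight u = course (weight_step u)"

lemma weight_eq: "weight u s = weight_step u s (weight u)"
proof -
  have "weight u s = weight_step u s (\<lambda>i. if i < s then weight u i else 0)"
    unfolding weight_def by (rule course_eq)
  also have "\<dots> = weight_step u s (weight u)"
  proof -
    have 1: "(\<exists>i<s. stage_prog i = stage_prog s \<and> \<not> fresh i \<and> 0 < (if i < s then weight u i else 0)) \<longleftrightarrow>
      (\<exists>i<s. stage_prog i = stage_prog s \<and> \<not> fresh i \<and> 0 < weight u i)" by auto
    have 2: "(\<exists>i<s. 0 < (if i < s then weight u i else 0) \<and>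
        (if i < s then weight u i else 0) \<le> guard (Suc (stage_prog s)) \<and> (stage_in s = i \<or> stage_in s = hits u i)) \<longleftrightarrow>
      (\<exists>i<s. 0 < weight u i \<and> weight u i \<le> guard (Suc (stage_prog s)) \<and> (stage_in s = i \<or> stage_in s = hits u i))"
      by auto
    show ?thesis unfolding weight_step_def 1 2 ..
  qed
  finally show ?thesis .
qed

lemma computable_in_fresh: "computable_in X f \<Longrightarrow> computable_in X (\<lambda>x. fresh (f x))"
proof -
  have "computable_in X fresh"
    unfolding fresh_def by (intro computable_in_accepted computable_in_stage computable_in_intros)
  then show "computable_in X f \<Longrightarrow> computable_in X (\<lambda>x. fresh (f x))" by (rule computable_in_comp)
qed

lemma computable_in_describes:
  "computable_in X f \<Longrightarrow> computable_in X (\<lambda>x. describes u (f x))"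
  unfolding describes_def by (intro computable_in_stage computable_in_intros)

lemma computable_in_hits: "computable_in X f \<Longrightarrow> computable_in X (\<lambda>x. hits u (f x))"
  unfolding hits_def by (intro computable_in_describes computable_in_stage computable_in_intros)

lemma computable_in_weight: "computable_in X (weight u)"
  unfolding weight_def
  by (rule computable_in_course, unfold weight_step_def)
    (intro computable_in_fresh computable_in_describes computable_in_hits computable_in_stage
      computable_in_accepted computable_in_str_len computable_in_guard computable_in_entry
      computable_in_intros)

lemma ex_fresh:
  assumes "n \<in> W e"
  shows "\<exists>t. fresh t \<and> stage_prog t = e \<and> stage_in t = n"
proof -
  define P where "P = (\<lambda>t. accepted t \<and> stage_prog t = e \<and> stage_in t = n)"
  have "\<exists>t. P t" using assms unfolding P_def W_iff by blast
  then obtain t where "P t" "\<forall>s<t. \<not> P s" using exists_least_iff[of P] by blast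
  then show ?thesis unfolding P_def fresh_def by blast
qed

lemma fresh_unique:
  assumes "fresh s" "fresh t" "stage_prog s = stage_prog t" "stage_in s = stage_in t"
  shows "s = t"
  using assms unfolding fresh_def by (metis linorder_cases)

lemma weight_fresh:
  "fresh t \<Longrightarrow> weight u t = Suc (if describes u t then str_len (fst (prod_decode (stage_in t)))
     else prod_encode (stage_prog t, stage_in t))"
  by (subst weight_eq) (simp add: weight_step_def)

text \<open>A string is no longer than its number, so descriptions satisfy the same bound as other
  computations.\<close>

lemma weight_fresh_le:
  assumes "fresh t"
  shows "weight u t \<le> Suc (prod_encode (stage_prog t, stage_in t))"
proof -
  have "str_len (fst (prod_decode m)) \<le> m" for m
    by (metis le_prod_encode_1 order_trans prod.collapse prod_decode_inverse str_len_le_self)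
  then have "str_len (fst (prod_decode (stage_in t))) \<le> prod_encode (stage_prog t, stage_in t)"
    by (meson le_prod_encode_2 order_trans)
  then show ?thesis using weight_fresh[OF assms] by simp
qed

lemma weight_stale:
  assumes "\<not> fresh t" "0 < weight u t"
  shows "weight u t = Suc (stage_prog t)" "accepted t" "stage_in t < t"
    "\<not> (\<exists>i<t. stage_prog i = stage_prog t \<and> \<not> fresh i \<and> 0 < weight u i)"
    "\<not> (\<exists>i<t. 0 < weight u i \<and> weight u i \<le> guard (Suc (stage_prog t)) \<and>
       (stage_in t = i \<or> stage_in t = hits u i))"
  using assms weight_eq[of u t] unfolding weight_step_def by (simp_all split: if_splits)

lemma inj_on_lessThan_card:
  fixes n :: nat
  assumes "inj_on f D" "f ` D \<subseteq> {..<n}"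
  shows "finite D" "card D \<le> n"
  using assms inj_on_finite[OF assms] card_inj_on_le[OF assms] by simp_all

text \<open>Descriptions are counted by programs of length less than \<open>k\<close>, other halting
  computations by their pair codes, and actions by their requirement. This gives
  \<open>2 ^ k + k + k\<close> at most.\<close>

lemma weight_card:
  "finite {t. 0 < weight u t \<and> weight u t \<le> k} \<and> card {t. 0 < weight u t \<and> weight u t \<le> k} \<le> 2 ^ (k + 1)"
proof -
  let ?D = "{t. fresh t \<and> describes u t \<and> weight u t \<le> k}"
  let ?F = "{t. fresh t \<and> \<not> describes u t \<and> weight u t \<le> k}"
  let ?S = "{t. \<not> fresh t \<and> 0 < weight u t \<and> weight u t \<le> k}"
  have "inj_on (\<lambda>t. fst (prod_decode (stage_in t))) ?D"
  proof (rule inj_onI)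
    fix s t assume st: "s \<in> ?D" "t \<in> ?D" "fst (prod_decode (stage_in s)) = fst (prod_decode (stage_in t))"
    then have "prod_decode (stage_in s) = prod_decode (stage_in t)"
      by (auto simp: describes_def prod_eq_iff)
    then have "stage_in s = stage_in t" by (metis prod_decode_inverse)
    moreover have "stage_prog s = stage_prog t" using st by (simp add: describes_def)
    ultimately show "s = t" using st fresh_unique by blast
  qed
  moreover have "(\<lambda>t. fst (prod_decode (stage_in t))) ` ?D \<subseteq> {..<2 ^ k}"
  proof clarsimp
    fix t assume t: "fresh t" "describes u t" "weight u t \<le> k"
    then have "Suc (str_len (fst (prod_decode (stage_in t)))) \<le> k" using weight_fresh[of t u] by simp
    moreover obtain p where "nat_of_str p = fst (prod_decode (stage_in t))"
      "length p = str_len (fst (prod_decode (stage_in t)))" by (rule obtain_str)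
    moreover have "(2::nat) ^ (length p + 1) \<le> 2 ^ k" using calculation by (intro power_increasing) auto
    ultimately show "fst (prod_decode (stage_in t)) < 2 ^ k" using nat_of_str_bounds(2)[of p] by simp
  qed
  ultimately have D: "finite ?D" "card ?D \<le> 2 ^ k"
    by (rule inj_on_lessThan_card)+
  have "inj_on (\<lambda>t. prod_encode (stage_prog t, stage_in t)) ?F"
    by (rule inj_onI) (simp, use fresh_unique in blast)
  moreover have "(\<lambda>t. prod_encode (stage_prog t, stage_in t)) ` ?F \<subseteq> {..<k}"
    by (rule image_subsetI) (clarsimp simp: weight_fresh)
  ultimately have F: "finite ?F" "card ?F \<le> k"
    by (rule inj_on_lessThan_card)+
  have "inj_on stage_prog ?S"
  proof (rule inj_onI)
    fix s t assume st: "s \<in> ?S" "t \<in> ?S" "stage_prog s = stage_prog t"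
    then show "s = t"
      using weight_stale(4)[of s u] weight_stale(4)[of t u] by (metis (mono_tags) linorder_cases mem_Collect_eq)
  qed
  moreover have "stage_prog ` ?S \<subseteq> {..<k}"
    by (rule image_subsetI) (clarsimp simp: weight_stale(1))
  ultimately have S: "finite ?S" "card ?S \<le> k"
    by (rule inj_on_lessThan_card)+
  have eq: "{t. 0 < weight u t \<and> weight u t \<le> k} = ?D \<union> ?F \<union> ?S"
    by (rule set_eqI) (auto simp: weight_fresh)
  have "card (?D \<union> ?F \<union> ?S) \<le> card ?D + card ?F + card ?S"
    by (meson add_le_mono1 card_Un_le le_trans)
  also have "\<dots> \<le> 2 ^ k + 2 * k" using D F S by simp
  also have "\<dots> \<le> 2 ^ (k + 1)"
  proof -
    have "k < 2 ^ k" by (rule less_exp)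
    moreover have "2 * m \<le> 2 ^ m" for m :: nat
    proof (cases m)
      case (Suc l)
      have "Suc l \<le> 2 ^ l" using less_exp[of l] by (simp only: Suc_le_eq)
      then show ?thesis unfolding Suc power_Suc by (rule mult_le_mono2)
    qed simp
    ultimately show ?thesis by simp
  qed
  finally show ?thesis using eq D(1) F(1) S(1) by simp
qed

lemma computable_event_system_weight: "computable_event_system (weight u) (hits u)"
proof
  show "hits u t \<le> t" for t using stage_le(3)[of t] by (auto simp: hits_def)
  show "finite {t. 0 < weight u t \<and> weight u t \<le> k}"
    "card {t. 0 < weight u t \<and> weight u t \<le> k} \<le> 2 ^ (k + 1)" for k
    using weight_card by blast+
  show "\<exists>t\<ge>b. 0 < weight u t" for b
  proof -
    \<comment> \<open>A program that halts everywhere provides events forever, and input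
      \<open>b\<close> cannot be accepted before stage \<open>b\<close>.\<close>
    have "b \<in> W (encode Zero)" unfolding W_def inv_f_f[OF inj_encode] by (simp add: dom_def)
    then obtain t where t: "fresh t" "stage_in t = b" using ex_fresh by blast
    then show ?thesis using stage_le(2)[of t] weight_fresh[of t u] by auto
  qed
  show "computable_in X (weight u)" for X by (rule computable_in_weight)
  show "computable_in X (hits u)" for X
    using computable_in_hits[OF computable_in_id] by simp
qed

interpretation E: computable_event_system "weight u" "hits u" for u
  by (rule computable_event_system_weight)

section \<open>Effective simplicity and Turing completeness\<close>

text \<open>If \<open>W e\<close> avoids \<open>A\<close>, its requirement never acts, as the action
  would put an element of \<open>W e\<close> into \<open>A\<close>. But it would act on any element
  outside \<open>protectable u (Suc e)\<close>, whose size is computably bounded.\<close>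

theorem effectively_simple_A: "effectively_simple (E.A u)"
proof -
  let ?f = "\<lambda>e. 2 ^ (guard (Suc e) + 2) :: nat"
  have "computable_in {} ?f" by (intro computable_in_guard computable_in_intros)
  then have "total_recursive ?f"
    unfolding total_recursive_def partial_recursive_def computable_in_def by (auto simp: fun_eq_iff)
  moreover have "finite (W e) \<and> card (W e) \<le> ?f e" if W: "W e \<subseteq> - E.A u" for e
  proof -
    have "W e \<subseteq> E.protectable u (Suc e)"
    proof (rule ccontr)
      assume "\<not> W e \<subseteq> E.protectable u (Suc e)"
      then obtain n where n: "n \<in> W e" "n \<notin> E.protectable u (Suc e)" by blast
      have no: "\<not> (\<exists>i. stage_prog i = e \<and> \<not> fresh i \<and> 0 < weight u i)"
      proof
        assume "\<exists>i. stage_prog i = e \<and> \<not> fresh i \<and> 0 < weight u i"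
        then obtain i where i: "stage_prog i = e" "\<not> fresh i" "0 < weight u i" by blast
        have "stage_in i \<in> W e" using weight_stale(2)[OF i(2,3)] i(1) W_iff by blast
        moreover have "E.dumped u (Suc i) (stage_in i)"
          unfolding E.dumped_def E.protected_def E.event_def
          using weight_stale[OF i(2,3)] i(1,3) by (intro exI[of _ i]) auto
        then have "stage_in i \<in> E.A u" unfolding E.A_def by blast
        ultimately show False using W by blast
      qed
      obtain t0 where t0: "fresh t0" "stage_prog t0 = e" "stage_in t0 = n" using ex_fresh n(1) by blast
      \<comment> \<open>Beyond \<open>t0\<close> the stage is not fresh, and beyond \<open>n\<close>
        the dump reaches \<open>n\<close>.\<close>
      obtain t where t: "t \<ge> Suc (max n t0)" "accepted t" "stage_prog t = e" "stage_in t = n"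
        using accepted_again[OF n(1)] by blast
      have "\<not> fresh t"
      proof
        assume "fresh t"
        then have "t = t0" using fresh_unique t0 t(3,4) by blast
        then show False using t(1) by simp
      qed
      moreover have "\<not> (\<exists>i<t. 0 < weight u i \<and> weight u i \<le> guard (Suc (stage_prog t)) \<and>
          (stage_in t = i \<or> stage_in t = hits u i))"
        using n(2) t unfolding E.protectable_def E.event_def by blast
      ultimately have "weight u t = Suc e"
        using t no by (subst weight_eq) (auto simp: weight_step_def)
      then show False using no t(3) \<open>\<not> fresh t\<close> by auto
    qed
    then show ?thesis
      using E.protectable[of u "Suc e"] by (meson card_mono finite_subset le_trans)
  qed
  ultimately show ?thesis
    unfolding effectively_simple_def using E.re_A E.infinite_compl_A by blast
qed

text \<open>With oracle \<open>A\<close>, search for a stage with so many survivors below it that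
  the event of the computation of program \<open>e\<close> on \<open>n\<close>, if there is one, has
  already happened. The search ends because the complement of \<open>A\<close> is infinite.\<close>

theorem T_complete_A: "T_complete (E.A u)"
proof -
  let ?A = "E.A u"
  have "turing_reducible B ?A" if "re B" for B
  proof -
    obtain e where B: "B = W e" using \<open>re B\<close> unfolding re_def by blast
    define P where "P = (\<lambda>n t. 2 ^ (guard (Suc (prod_encode (e, n))) + 2) < card {y. y < t \<and> y \<notin> ?A})"
    define f where "f = (\<lambda>n t. \<exists>s<t. accepted s \<and> stage_prog s = e \<and> stage_in s = (n::nat))"
    have "computable_in ?A (\<lambda>u. P (fst u) (snd u))"
      unfolding P_def by (intro computable_in_guard computable_in_intros)
    moreover have "computable_in ?A (\<lambda>u. f (fst u) (snd u))"
      unfolding f_def by (intro computable_in_accepted computable_in_stage computable_in_intros)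
    ultimately obtain c where c: "\<forall>n. eval ?A c n =
        (if \<exists>t. P n t then Some (of_bool (f n (LEAST t. P n t))) else None)"
      using computable_in_search[of ?A P f] by (auto simp: code_bool_def cong: if_cong)
    have ex: "\<exists>t. P n t" for n
    proof -
      obtain Y where Y: "Y \<subseteq> - ?A" "finite Y" "card Y = Suc (2 ^ (guard (Suc (prod_encode (e, n))) + 2))"
        using infinite_arbitrarily_large[OF E.infinite_compl_A] by blast
      obtain t where "\<forall>y\<in>Y. y < t" using Y(2) finite_nat_set_iff_bounded by blast
      then have "card Y \<le> card {y. y < t \<and> y \<notin> ?A}" using Y(1) by (intro card_mono) auto
      then show ?thesis using Y(3) unfolding P_def by (intro exI[of _ t]) simp
    qed
    have "f n (LEAST t. P n t) \<longleftrightarrow> n \<in> B" for n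
    proof
      assume "n \<in> B"
      then obtain t0 where t0: "fresh t0" "stage_prog t0 = e" "stage_in t0 = n"
        using ex_fresh B by blast
      have "E.event u (Suc (prod_encode (e, n))) t0"
        unfolding E.event_def using weight_fresh[OF t0(1)] weight_fresh_le[OF t0(1), of u] t0 by simp
      moreover have "P n (LEAST t. P n t)" using ex by (rule LeastI_ex)
      ultimately have "t0 < (LEAST t. P n t)"
        using E.no_event_after_many unfolding P_def by (meson not_less)
      then show "f n (LEAST t. P n t)" using t0 unfolding f_def fresh_def by blast
    qed (auto simp: f_def B W_iff)
    then show ?thesis unfolding turing_reducible_def using c ex by (auto intro!: exI[of _ c])
  qed
  then show ?thesis unfolding T_complete_def using E.re_A by blast
qed

section \<open>Programs for instance complexity\<close>

text \<open>A single mapping runs the search \<open>P\<close>, uses \<open>D\<close> to choose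
  between an answer and \<open>Bot\<close>, and answers with \<open>R\<close>. Optimality then gives
  a constant independent of the parameter \<open>w\<close>, the instance and the set.\<close>

lemma ic_search:
  fixes P D R :: "nat \<Rightarrow> nat \<Rightarrow> nat \<Rightarrow> bool"
  assumes opt: "optimal U"
    and P: "computable_in {} (\<lambda>u. P (fst (fst u)) (snd (fst u)) (snd u))"
    and D: "computable_in {} (\<lambda>u. D (fst (fst u)) (snd (fst u)) (snd u))"
    and R: "computable_in {} (\<lambda>u. R (fst (fst u)) (snd (fst u)) (snd u))"
  obtains d where "\<And>w x S. \<lbrakk>\<And>z. \<exists>t. P w z t;
      \<And>z t. t = (LEAST t. P w z t) \<Longrightarrow> D w z t \<Longrightarrow> R w z t \<longleftrightarrow> z \<in> S;
      D w (nat_of_str x) (LEAST t. P w (nat_of_str x) t)\<rbrakk>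
    \<Longrightarrow> ic U x (strs S) \<le> enat (str_len w + d)"
proof -
  let ?L = "\<lambda>w z. LEAST t. P w z t"
  define V :: mapping where "V = (\<lambda>(p, z).
    if \<exists>t. P (nat_of_str p) (nat_of_str z) t
    then Some (if D (nat_of_str p) (nat_of_str z) (?L (nat_of_str p) (nat_of_str z))
      then Str [R (nat_of_str p) (nat_of_str z) (?L (nat_of_str p) (nat_of_str z))] else Bot)
    else None)"
  \<comment> \<open>The values 3, 2 and 0 are the codes under \<open>nat_of_out\<close> of the
    strings 1 and 0 and of \<open>Bot\<close>.\<close>
  define f where "f = (\<lambda>u t. if D (fst u) (snd u) t then if R (fst u) (snd u) t then 3 else 2 else 0 :: nat)"
  have "computable_in {} (\<lambda>u. f (fst u) (snd u))"
    unfolding f_def by (intro computable_in_if D R computable_in_const)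
  then obtain c where c: "\<forall>x. eval {} c (code x) = (if \<exists>t. P (fst x) (snd x) t
      then Some (code (f x (LEAST t. P (fst x) (snd x) t))) else None)"
    using computable_in_search[of "{}" "\<lambda>u. P (fst u) (snd u)" f] P by auto
  have c': "eval {} c (prod_encode (w, z)) = (if \<exists>t. P w z t then Some (f (w, z) (?L w z)) else None)" for w z
    using c[rule_format, of "(w, z)"] by (simp add: code_prod_def)
  have "nat_of_str [b] = (if b then 2 else 1)" for b using nat_of_str_snoc[of "[]" b] by simp
  then have "eval {} c (prod_encode (nat_of_str p, nat_of_str z)) = map_option nat_of_out (V (p, z))" for p z
    unfolding c' V_def f_def by simp
  then have "partial_recursive_mapping V"
    unfolding partial_recursive_mapping_def partial_recursive_def by blast
  then obtain d where d: "\<forall>x A. C U x \<le> C V x + enat d \<and> ic U x A \<le> ic V x A + enat d"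
    using opt unfolding optimal_def by blast
  show thesis
  proof (rule that)
    fix w x S
    assume tot: "\<And>z. \<exists>t. P w z t"
      and con: "\<And>z t. t = ?L w z \<Longrightarrow> D w z t \<Longrightarrow> R w z t \<longleftrightarrow> z \<in> S"
      and dec: "D w (nat_of_str x) (?L w (nat_of_str x))"
    obtain p where p: "nat_of_str p = w" "length p = str_len w" by (rule obtain_str)
    have V: "V (p, z) = Some (if D w (nat_of_str z) (?L w (nat_of_str z)) then chi (strs S) z else Bot)" for z
      using tot[of "nat_of_str z"] con[OF refl, of "nat_of_str z"]
      by (simp add: V_def p chi_def strs_def)
    have "ic V x (strs S) \<le> enat (length p)"
      unfolding ic_def
    proof (rule Inf_lower, rule CollectI, intro exI conjI)
      show "dom (\<lambda>z. V (p, z)) = UNIV" by (auto simp: V)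
      show "consistent (strs S) (\<lambda>z. V (p, z))" by (simp add: consistent_def V)
      show "V (p, x) = Some (chi (strs S) x)" using dec by (simp add: V)
    qed simp
    then have "ic V x (strs S) + enat d \<le> enat (length p) + enat d" by (rule add_right_mono)
    then show "ic U x (strs S) \<le> enat (str_len w + d)"
      using d p(2) by (metis order_trans plus_enat_simps(1))
  qed
qed

text \<open>A pairing whose code length is that of the second component plus \<open>2 * s + 1\<close>, as long as the
  first component is below \<open>2 ^ s\<close>.\<close>

definition pack :: "nat \<Rightarrow> nat \<Rightarrow> nat \<Rightarrow> nat" where
  "pack s a b = 2 ^ s * (2 * (b * 2 ^ s + a) + 1)"

text \<open>In binary, a packed number consists of \<open>b\<close>, then \<open>a\<close> in
  \<open>s\<close> digits, a one and \<open>s\<close> zeros; the final zeros reveal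
  \<open>s\<close>.\<close>

definition trailing :: "nat \<Rightarrow> nat" where
  "trailing w = card {j. j < w \<and> (\<forall>i<Suc j. even (w div 2 ^ i))}"

definition unpack1 :: "nat \<Rightarrow> nat" where
  "unpack1 w = w div 2 ^ Suc (trailing w) mod 2 ^ trailing w"

definition unpack2 :: "nat \<Rightarrow> nat" where
  "unpack2 w = w div 2 ^ Suc (trailing w) div 2 ^ trailing w"

lemma trailing: "trailing (2 ^ s * (2 * y + 1)) = s"
proof -
  let ?w = "2 ^ s * (2 * y + 1) :: nat"
  have div: "?w div 2 ^ i = 2 ^ (s - i) * (2 * y + 1)" if "i \<le> s" for i
  proof -
    have "(2::nat) ^ s = 2 ^ i * 2 ^ (s - i)" using that by (simp flip: power_add)
    then have "?w = 2 ^ i * (2 ^ (s - i) * (2 * y + 1))" by (simp only: mult.assoc)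
    then show ?thesis by (metis nonzero_mult_div_cancel_left power_not_zero zero_neq_numeral)
  qed
  have s: "s < ?w" using less_exp[of s] by (rule less_le_trans) simp
  have "{j. j < ?w \<and> (\<forall>i<Suc j. even (?w div 2 ^ i))} = {..<s}"
  proof (rule set_eqI)
    fix j
    show "j \<in> {j. j < ?w \<and> (\<forall>i<Suc j. even (?w div 2 ^ i))} \<longleftrightarrow> j \<in> {..<s}"
    proof (cases "j < s")
      case True
      then have "even (?w div 2 ^ i)" if "i < Suc j" for i
        using that div[of i] by simp
      then show ?thesis using True s by (simp only: mem_Collect_eq lessThan_iff) (meson less_trans)
    next
      case False
      then have "s < Suc j" by simp
      moreover have "odd (?w div 2 ^ s)" using div[of s] by simp
      ultimately show ?thesis using False by (simp only: mem_Collect_eq lessThan_iff) blast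
    qed
  qed
  then show ?thesis unfolding trailing_def by simp
qed

lemma unpack_pack:
  assumes "a < 2 ^ s"
  shows "unpack1 (pack s a b) = a" "unpack2 (pack s a b) = b"
proof -
  have t: "trailing (pack s a b) = s" unfolding pack_def by (rule trailing)
  have "pack s a b div 2 ^ Suc s = pack s a b div 2 ^ s div 2"
    by (simp only: power_Suc2 div_mult2_eq)
  also have "pack s a b div 2 ^ s = 2 * (b * 2 ^ s + a) + 1" unfolding pack_def by simp
  also have "(2 * (b * 2 ^ s + a) + 1) div 2 = b * 2 ^ s + a" by simp
  finally have d: "pack s a b div 2 ^ Suc s = b * 2 ^ s + a" .
  show "unpack1 (pack s a b) = a" "unpack2 (pack s a b) = b"
    unfolding unpack1_def unpack2_def t d using assms by simp_all
qed

lemma str_len_pack: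
  assumes "a < 2 ^ s" "b < 2 ^ l"
  shows "str_len (pack s a b) \<le> 2 * s + 1 + l"
proof (rule str_len_le)
  have "b * 2 ^ s + a < (b + 1) * 2 ^ s" using assms(1) by (simp add: distrib_right)
  also have "\<dots> \<le> 2 ^ l * 2 ^ s" using assms(2) by (intro mult_le_mono) auto
  finally have "2 * (b * 2 ^ s + a) + 1 < 2 * (2 ^ l * 2 ^ s)" by simp
  then have "pack s a b < 2 ^ s * (2 * (2 ^ l * 2 ^ s))"
    unfolding pack_def by (rule mult_strict_left_mono) simp
  also have "\<dots> = 2 ^ (2 * s + 1 + l)" by (simp only: power_add mult_2[of s] power_one_right) simp
  finally show "pack s a b + 1 < 2 ^ (2 * s + 1 + l + 1)" by simp
qed

lemma computable_in_unpack:
  "computable_in X f \<Longrightarrow> computable_in X (\<lambda>x. unpack1 (f x))"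
  "computable_in X f \<Longrightarrow> computable_in X (\<lambda>x. unpack2 (f x))"
proof -
  have "computable_in X trailing" unfolding trailing_def [abs_def] by (intro computable_in_intros)
  note t = computable_in_comp[OF this]
  show "computable_in X f \<Longrightarrow> computable_in X (\<lambda>x. unpack1 (f x))"
    "computable_in X f \<Longrightarrow> computable_in X (\<lambda>x. unpack2 (f x))"
    unfolding unpack1_def unpack2_def by (intro t computable_in_intros; assumption)+
qed

section \<open>Size of packed parameters\<close>

lemma prod_encode_le: "prod_encode (a, b) \<le> (a + b + 1) ^ 2"
proof -
  have "triangle (a + b) \<le> (a + b) * (a + b + 1)" by (simp add: triangle_def)
  then have "prod_encode (a, b) \<le> (a + b) * (a + b + 1) + a" by (simp add: prod_encode_def)
  also have "\<dots> \<le> (a + b + 1) ^ 2" by (simp add: power2_eq_square)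
  finally show ?thesis .
qed

lemma prod_encode4_le:
  assumes B: "2 \<le> B" and k: "k < B" and l: "l < B" and mn: "m + n < B"
  shows "prod_encode (k, prod_encode (l, prod_encode (m, n))) \<le> B ^ 14"
proof -
  \<comment> \<open>Each further pairing takes the exponent \<open>r\<close> to
    \<open>2 * (r + 1)\<close>, so the exponents are 2, 6 and 14.\<close>
  have step: "prod_encode (a, b) \<le> B ^ (2 * (r + 1))" if "a < B" "b \<le> B ^ r" "1 \<le> r" for a b r
  proof -
    have "B ^ 1 \<le> B ^ r" using B that(3) by (intro power_increasing) auto
    then have "a + b + 1 \<le> B ^ r + B ^ r" using that by simp
    also have "\<dots> \<le> B * B ^ r" using B by (simp flip: mult_2)
    finally have "(a + b + 1) ^ 2 \<le> (B ^ (r + 1)) ^ 2" by (intro power_mono) auto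
    also have "\<dots> = B ^ (2 * (r + 1))" by (simp only: power_mult[symmetric] mult.commute[of 2])
    finally show ?thesis using prod_encode_le[of a b] by simp
  qed
  have "prod_encode (m, n) \<le> B ^ 2"
    by (rule order_trans[OF prod_encode_le]) (use mn in \<open>simp add: power_mono\<close>)
  then have "prod_encode (l, prod_encode (m, n)) \<le> B ^ 6" using step[of l _ 2] l by simp
  then show ?thesis using step[of k _ 6] k by simp
qed

lemma parameters_fit:
  assumes m: "2 ^ 196 \<le> m" and le: "k \<le> 4096 * m" "l \<le> 4096 * m" "e \<le> 4096 * m" "n \<le> 4096 * m + 2"
  shows "prod_encode (k, prod_encode (l, prod_encode (e, n))) < 2 ^ (16 * m)"
proof -
  \<comment> \<open>\<open>?B\<close> exceeds all parameters and the sum of the last two. Its 14th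
    power contains the factor \<open>2 ^ 196\<close>, which \<open>m\<close> absorbs.\<close>
  let ?B = "2 ^ 14 * (m + 1)"
  have "prod_encode (k, prod_encode (l, prod_encode (e, n))) \<le> ?B ^ 14"
    using le by (intro prod_encode4_le) simp_all
  also have "?B ^ 14 = 2 ^ 196 * (m + 1) ^ 14" unfolding power_mult_distrib by (simp flip: power_mult)
  also have "\<dots> \<le> (m + 1) * (m + 1) ^ 14" using m by (intro mult_le_mono) simp_all
  also have "\<dots> = (m + 1) ^ 15" by (simp only: power_Suc[symmetric]) simp
  also have "\<dots> < (m + 1) ^ 16" using m by (intro power_strict_increasing) auto
  also have "\<dots> \<le> (2 ^ m) ^ 16"
    using less_exp[of m] by (intro power_mono) (simp_all only: Suc_eq_plus1[symmetric] Suc_le_eq)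
  also have "\<dots> = 2 ^ (16 * m)" by (simp add: power_mult[symmetric] mult.commute)
  finally show ?thesis .
qed

section \<open>Descriptions and their events\<close>

text \<open>Comparison with the mapping that outputs its own program.\<close>

lemma C_finite:
  assumes "optimal U"
  shows "C U x \<noteq> \<infinity>"
proof -
  define V :: mapping where "V = (\<lambda>(p, z). Some (Str p))"
  have "eval {} (Compose Successor First) (prod_encode (nat_of_str p, nat_of_str z)) =
      map_option nat_of_out (V (p, z))" for p z
    by (simp add: V_def)
  then have "partial_recursive_mapping V"
    unfolding partial_recursive_mapping_def partial_recursive_def by blast
  then obtain d where "C U x \<le> C V x + enat d" using assms unfolding optimal_def by blast
  moreover have "C V x \<le> enat (length x)"
    unfolding C_def by (rule Inf_lower) (auto simp: V_def)
  ultimately have *: "C U x \<le> enat (length x + d)"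
    by (metis add_right_mono order_trans plus_enat_simps(1))
  show ?thesis
  proof
    assume "C U x = \<infinity>"
    then show False using * by simp
  qed
qed

lemma C_attained:
  assumes "C U x = enat k"
  obtains p where "length p = k" "U (p, []) = Some (Str x)"
proof -
  let ?S = "{enat (length p) | p. U (p, []) = Some (Str x)}"
  have "?S \<noteq> {}" using assms unfolding C_def Inf_enat_def by (auto split: if_splits)
  then have "C U x \<in> ?S" unfolding C_def Inf_enat_def by (simp only: if_False) (rule LeastI_ex, blast)
  then show thesis using that assms by auto
qed

text \<open>A shortest description of \<open>x\<close> first appears at a fresh stage, whose event
  has the complexity of \<open>x\<close> as its weight.\<close>

lemma ex_hit:
  assumes g: "\<forall>p z. eval {} c (prod_encode (nat_of_str p, nat_of_str z)) = map_option nat_of_out (U (p, z))"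
    and C: "C U x = enat k"
  obtains t where "hits (encode c) t = nat_of_str x" "weight (encode c) t = Suc k"
proof -
  obtain p where p: "length p = k" "U (p, []) = Some (Str x)" using C by (rule C_attained)
  let ?n = "prod_encode (nat_of_str p, 0)"
  have ev: "eval {} c ?n = Some (Suc (nat_of_str x))" using g[rule_format, of p "[]"] p(2) by simp
  then have "?n \<in> W (encode c)" unfolding W_def inv_f_f[OF inj_encode] by blast
  then obtain t where t: "fresh t" "stage_prog t = encode c" "stage_in t = ?n" using ex_fresh by blast
  then have out: "stage_out t = Suc (nat_of_str x)"
    using accepted_sound[of t c] ev unfolding fresh_def by simp
  have d: "describes (encode c) t" using t out by (simp add: describes_def)
  show thesis
    by (rule that[of t]) (use t d out p(1) in \<open>simp_all add: hits_def weight_fresh str_len_nat_of_str\<close>)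
qed

section \<open>Upper bounds for instance complexity\<close>

context computable_event_system
begin

text \<open>The parameters \<open>T\<close>, \<open>k\<close>, \<open>e\<close> and \<open>j\<close>
  fit into \<open>16 * m\<close> bits, which packing doubles. Only the rounded count
  \<open>p\<close> may be long, so it is the component that packing does not double.\<close>

lemma counter_ic:
  assumes "optimal U"
  obtains d where "\<And>T i k e p l m x. \<lbrakk>T = 16 ^ i; k \<le> 16 * T; p * 2 ^ e \<le> total k;
      \<And>t. p * 2 ^ e \<le> cnt k t \<Longrightarrow> \<not> event T t;
      cnt k (nat_of_str x) < p * 2 ^ e \<or> (\<exists>t\<ge>nat_of_str x. event (16 * T) t);
      2 ^ 196 \<le> m; 16 * T \<le> 4096 * m; e \<le> 4096 * m; p < 2 ^ l\<rbrakk>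
    \<Longrightarrow> ic U x (strs A) \<le> enat (32 * m + 1 + l + d)"
proof -
  define f1 where "f1 = (\<lambda>w. fst (prod_decode (unpack1 w)))"
  define f2 where "f2 = (\<lambda>w. fst (prod_decode (snd (prod_decode (unpack1 w)))))"
  define f3 where "f3 = (\<lambda>w. fst (prod_decode (snd (prod_decode (snd (prod_decode (unpack1 w)))))))"
  define f4 where "f4 = (\<lambda>w. snd (prod_decode (snd (prod_decode (snd (prod_decode (unpack1 w)))))))"
  define P where "P = (\<lambda>w. ticking (f1 w) (f2 w) (unpack2 w * 2 ^ f3 w) (f4 w))"
  have cP: "computable_in {} (\<lambda>u. P (fst (fst u)) (snd (fst u)) (snd u))"
    unfolding P_def f1_def f2_def f3_def f4_def
    by (intro computable_in_ticking computable_in_unpack computable_in_intros)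
  have cD: "computable_in {} (\<lambda>u. (snd (fst u) :: nat) < snd (u :: (nat \<times> nat) \<times> nat))"
    by (intro computable_in_intros)
  have cR: "computable_in {} (\<lambda>u. dumped (snd u) (snd (fst (u :: (nat \<times> nat) \<times> nat))))"
    by (intro computable_in_dumped computable_in_intros)
  obtain d where d: "\<And>w x S. \<lbrakk>\<And>z. \<exists>t. P w z t;
      \<And>z t. t = (LEAST t. P w z t) \<Longrightarrow> z < t \<Longrightarrow> dumped t z \<longleftrightarrow> z \<in> S;
      nat_of_str x < (LEAST t. P w (nat_of_str x) t)\<rbrakk>
    \<Longrightarrow> ic U x (strs S) \<le> enat (str_len w + d)"
    using ic_search[OF assms cP, of "\<lambda>w z t. z < t" "\<lambda>w z t. dumped t z"] cD cR by blast
  show thesis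
  proof (rule that)
    fix T i k e p l m x
    assume T: "T = 16 ^ i" and k: "k \<le> 16 * T" and tot: "p * 2 ^ e \<le> total k"
      and quiet: "\<And>t. p * 2 ^ e \<le> cnt k t \<Longrightarrow> \<not> event T t"
      and x: "cnt k (nat_of_str x) < p * 2 ^ e \<or> (\<exists>t\<ge>nat_of_str x. event (16 * T) t)"
      and m: "2 ^ 196 \<le> m" and le: "16 * T \<le> 4096 * m" "e \<le> 4096 * m" and p: "p < 2 ^ l"
    obtain j where j: "2 ^ j \<le> Suc (total (16 * T))"
      "\<And>z. \<exists>t. ticking T k (p * 2 ^ e) j z t"
      "\<And>z t. t = (LEAST t. ticking T k (p * 2 ^ e) j z t) \<Longrightarrow> z < t \<Longrightarrow> dumped t z \<longleftrightarrow> z \<in> A"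
      "nat_of_str x < (LEAST t. ticking T k (p * 2 ^ e) j (nat_of_str x) t)"
      using counter_programs[OF T k tot quiet x] by blast
    have "(2::nat) ^ j < 2 ^ (16 * T + 2)"
    proof -
      have "Suc (total (16 * T)) \<le> Suc (2 ^ (16 * T + 1))" using total_le by simp
      also have "\<dots> < 2 * 2 ^ (16 * T + 1)" using less_exp[of "16 * T + 1"] by linarith
      also have "\<dots> = 2 ^ (16 * T + 2)" by simp
      finally show ?thesis using j(1) by simp
    qed
    then have "j < 16 * T + 2" by (rule power_less_imp_less_exp[rotated]) simp
    let ?a = "prod_encode (T, prod_encode (k, prod_encode (e, j)))" and ?w = "pack (16 * m)"
    have a: "?a < 2 ^ (16 * m)"
      using m le k \<open>j < 16 * T + 2\<close> by (intro parameters_fit) linarith+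
    have "P (?w ?a p) = ticking T k (p * 2 ^ e) j"
      unfolding P_def f1_def f2_def f3_def f4_def by (simp add: unpack_pack[OF a])
    then have "ic U x (strs A) \<le> enat (str_len (?w ?a p) + d)" using j by (intro d) simp_all
    also have "\<dots> \<le> enat (32 * m + 1 + l + d)" using str_len_pack[OF a p] by simp
    finally show "ic U x (strs A) \<le> enat (32 * m + 1 + l + d)" .
  qed
qed

text \<open>The second packed component joins \<open>total T\<close>, below
  \<open>2 ^ (T + 2)\<close>, with the \<open>8 * T\<close> bits of \<open>m\<close>. Together with
  \<open>2 * T + 1\<close> bits for \<open>T\<close> this gives \<open>11 * T + 3\<close>.\<close>

lemma short_round_ic:
  assumes "optimal U"
  obtains d where "\<And>T i t0 Q x. \<lbrakk>T = 16 ^ i; event (20 * T) t0; hit t0 = nat_of_str x;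
      event (16 * T) Q; Q < nat_of_str x; \<And>u. Q < u \<Longrightarrow> \<not> event (16 * T) u;
      2 ^ (8 * T) * (total (20 * T) div 2 ^ (8 * T)) \<le> cnt (20 * T) Q\<rbrakk>
    \<Longrightarrow> ic U x (strs A) \<le> enat (11 * T + 3 + d)"
proof -
  define P where "P = (\<lambda>w. late (unpack1 w) (unpack2 w div 2 ^ (8 * unpack1 w))
    (unpack2 w mod 2 ^ (8 * unpack1 w)))"
  have cP: "computable_in {} (\<lambda>u. P (fst (fst u)) (snd (fst u)) (snd u))"
    unfolding P_def by (intro computable_in_late computable_in_unpack computable_in_intros)
  have cD: "computable_in {} (\<lambda>u. hit_before (unpack1 (fst (fst u))) (snd (fst u)) (snd (u :: (nat \<times> nat) \<times> nat)))"
    by (intro computable_in_hit_before computable_in_unpack computable_in_intros)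
  have cR: "computable_in {} (\<lambda>u. dumped (snd u) (snd (fst (u :: (nat \<times> nat) \<times> nat))))"
    by (intro computable_in_dumped computable_in_intros)
  obtain d where d: "\<And>w x S. \<lbrakk>\<And>z. \<exists>t. P w z t;
      \<And>z t. t = (LEAST t. P w z t) \<Longrightarrow> hit_before (unpack1 w) z t \<Longrightarrow> dumped t z \<longleftrightarrow> z \<in> S;
      hit_before (unpack1 w) (nat_of_str x) (LEAST t. P w (nat_of_str x) t)\<rbrakk>
    \<Longrightarrow> ic U x (strs S) \<le> enat (str_len w + d)"
    using ic_search[OF assms cP, of "\<lambda>w. hit_before (unpack1 w)" "\<lambda>w z t. dumped t z"] cD cR by blast
  show thesis
  proof (rule that)
    fix T i t0 Q x
    assume T: "T = 16 ^ i" and t0: "event (20 * T) t0" "hit t0 = nat_of_str x"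
      and Q: "event (16 * T) Q" "Q < nat_of_str x" "\<And>u. Q < u \<Longrightarrow> \<not> event (16 * T) u"
      and L: "2 ^ (8 * T) * (total (20 * T) div 2 ^ (8 * T)) \<le> cnt (20 * T) Q"
    obtain m where m: "m < 2 ^ (8 * T)" "\<And>z. \<exists>t. late T (total T) m z t"
      "\<And>z t. t = (LEAST t. late T (total T) m z t) \<Longrightarrow> hit_before T z t \<Longrightarrow> dumped t z \<longleftrightarrow> z \<in> A"
      "hit_before T (nat_of_str x) (LEAST t. late T (total T) m (nat_of_str x) t)"
      using short_round_programs[OF T t0 Q _ L] by auto
    let ?b = "total T * 2 ^ (8 * T) + m"
    have a: "T < 2 ^ T" by (rule less_exp)
    have "?b < (total T + 1) * 2 ^ (8 * T)" using m(1) by (simp add: distrib_right)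
    also have "\<dots> \<le> 2 ^ (T + 2) * 2 ^ (8 * T)"
    proof (rule mult_le_mono1)
      have "total T + 1 \<le> 2 ^ (T + 1) + 1" using total_le[of T] by simp
      also have "\<dots> \<le> 2 ^ (T + 2)" using one_le_power[of "2::nat" T] by simp
      finally show "total T + 1 \<le> 2 ^ (T + 2)" .
    qed
    also have "\<dots> = 2 ^ (9 * T + 2)" by (simp only: power_add[symmetric]) simp
    finally have b: "?b < 2 ^ (9 * T + 2)" .
    have P: "P (pack T T ?b) = late T (total T) m" "unpack1 (pack T T ?b) = T"
      unfolding P_def using m(1) by (simp_all add: unpack_pack[OF a])
    then have "ic U x (strs A) \<le> enat (str_len (pack T T ?b) + d)" using m by (intro d) simp_all
    also have "\<dots> \<le> enat (11 * T + 3 + d)" using str_len_pack[OF a b] by simp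
    finally show "ic U x (strs A) \<le> enat (11 * T + 3 + d)" .
  qed
qed

text \<open>Up to constants, the program lengths are \<open>18 * \<kappa>\<close> for weights from
  \<open>20 * \<kappa>\<close> on, and otherwise \<open>14 * \<kappa>\<close>,
  \<open>3 * \<kappa>\<close> or \<open>11 * \<kappa>\<close> for weights of at least
  \<open>16 * \<kappa>\<close>. Each case leaves a margin of at least
  \<open>2 * \<kappa>\<close>.\<close>

theorem ic_below_weight:
  assumes "optimal U"
  shows "\<exists>K. \<forall>x t k. hit t = nat_of_str x \<longrightarrow> wt t = Suc k \<longrightarrow> K \<le> k \<longrightarrow>
    ic U x (strs A) + enat c < enat k"
proof -
  obtain d1 where d1: "\<And>T i k e p l m x. \<lbrakk>T = 16 ^ i; k \<le> 16 * T; p * 2 ^ e \<le> total k;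
      \<And>t. p * 2 ^ e \<le> cnt k t \<Longrightarrow> \<not> event T t;
      cnt k (nat_of_str x) < p * 2 ^ e \<or> (\<exists>t\<ge>nat_of_str x. event (16 * T) t);
      2 ^ 196 \<le> m; 16 * T \<le> 4096 * m; e \<le> 4096 * m; p < 2 ^ l\<rbrakk>
    \<Longrightarrow> ic U x (strs A) \<le> enat (32 * m + 1 + l + d1)"
    using counter_ic[OF assms] by blast
  obtain d2 where d2: "\<And>T i t0 Q x. \<lbrakk>T = 16 ^ i; event (20 * T) t0; hit t0 = nat_of_str x;
      event (16 * T) Q; Q < nat_of_str x; \<And>u. Q < u \<Longrightarrow> \<not> event (16 * T) u;
      2 ^ (8 * T) * (total (20 * T) div 2 ^ (8 * T)) \<le> cnt (20 * T) Q\<rbrakk>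
    \<Longrightarrow> ic U x (strs A) \<le> enat (11 * T + 3 + d2)"
    using short_round_ic[OF assms] by blast
  \<comment> \<open>The factor 4096 matches \<open>k0 < 4096 * m\<close>, so that \<open>m\<close>
    exceeds all constants involved.\<close>
  define K where "K = 4096 * (2 ^ 196 + d1 + d2 + c + 10)"
  show ?thesis
  proof (intro exI allI impI)
    fix x t0 k0
    assume hit: "hit t0 = nat_of_str x" and wt: "wt t0 = Suc k0" and K: "K \<le> k0"
    have xt0: "nat_of_str x \<le> t0" using hit_le[of t0] hit wt by simp
    obtain m i where m: "m = 16 ^ i" "256 * m \<le> k0" "k0 < 4096 * m"
    proof -
      define Q where "Q = (\<lambda>i. k0 < 4096 * 16 ^ i)"
      have "k0 < 16 ^ k0" using less_exp[of k0] by (rule less_le_trans) (simp add: power_mono)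
      then have "\<exists>i. Q i" unfolding Q_def by (intro exI[of _ k0]) simp
      then obtain i where i: "Q i" "\<forall>j<i. \<not> Q j" using exists_least_iff[of Q] by blast
      have "256 * 16 ^ i \<le> k0"
      proof (cases i)
        case 0
        then show ?thesis using K by (simp add: K_def)
      next
        case (Suc j)
        then show ?thesis using i(2) unfolding Q_def by auto
      qed
      then show thesis using i(1) that[of "16 ^ i" i] unfolding Q_def by simp
    qed
    have big: "2 ^ 196 + d1 + d2 + c + 10 < m"
      using K m(3) unfolding K_def by (meson le_less_trans mult_less_cancel1)
    \<comment> \<open>\<open>\<kappa>\<close> is a power of 16 with
      \<open>16 * \<kappa> \<le> k0 < 256 * \<kappa>\<close>.\<close>
    define \<kappa> where "\<kappa> = 16 * m"
    have \<kappa>: "\<kappa> = 16 ^ (i + 1)" "16 * \<kappa> = 16 ^ (i + 2)" "m \<le> \<kappa>" by (simp_all add: \<kappa>_def m(1))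
    have big': "2 ^ 196 \<le> m" using big by simp
    have total_less: "total j < 2 ^ (j + 2)" for j
      using total_le[of j] by (rule le_less_trans) simp
    have quiet: "\<not> event j t" if "total j * 2 ^ 0 \<le> cnt j t" for j t
      using no_event_after[of j t t] cnt_le_total[of j t] that by simp
    consider (high) "20 * \<kappa> \<le> k0" | (gap) "k0 < 20 * \<kappa>" by linarith
    then show "ic U x (strs A) + enat c < enat k0"
    proof cases
      case high
      have "event (16 * (16 * \<kappa>)) t0" using wt m(3) by (simp add: event_def \<kappa>_def)
      then have "ic U x (strs A) \<le> enat (32 * m + 1 + (16 * \<kappa> + 2) + d1)"
        by (intro d1[OF \<kappa>(2), where k = "16 * \<kappa>" and p = "total (16 * \<kappa>)" and e = 0])
          (use xt0 quiet total_less[of "16 * \<kappa>"] big' in \<open>auto simp: \<kappa>_def\<close>)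
      then have "ic U x (strs A) + enat c \<le> enat (32 * m + 1 + (16 * \<kappa> + 2) + d1) + enat c"
        by (rule add_right_mono)
      also have "\<dots> < enat k0" using high big by (simp add: \<kappa>_def)
      finally show ?thesis .
    next
      case gap
      have e0: "event (20 * \<kappa>) t0" using wt gap by (simp add: event_def)
      let ?p = "total (20 * \<kappa>) div 2 ^ (8 * \<kappa>)"
      have v: "?p * 2 ^ (8 * \<kappa>) \<le> total (20 * \<kappa>)" by (rule div_times_less_eq_dividend)
      show ?thesis
      \<comment> \<open>Rounding saves \<open>8 * \<kappa>\<close> of about
        \<open>20 * \<kappa>\<close> bits. The question is whether the rounded count still certifies
        that events of weight below \<open>16 * \<kappa>\<close> are over.\<close>
      proof (cases "\<exists>t. ?p * 2 ^ (8 * \<kappa>) \<le> cnt (20 * \<kappa>) t \<and> event (16 * \<kappa>) t")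
        case False
        have "?p < 2 ^ (12 * \<kappa> + 2)"
        proof (rule less_mult_imp_div_less)
          show "total (20 * \<kappa>) < 2 ^ (12 * \<kappa> + 2) * 2 ^ (8 * \<kappa>)"
            using total_less[of "20 * \<kappa>"] by (simp only: power_add[symmetric]) simp
        qed
        moreover have "event (16 * (16 * \<kappa>)) t0" using e0 by (simp add: event_def)
        ultimately have "ic U x (strs A) \<le> enat (32 * m + 1 + (12 * \<kappa> + 2) + d1)"
          by (intro d1[OF \<kappa>(2), where k = "20 * \<kappa>" and p = ?p and e = "8 * \<kappa>"])
            (use xt0 False v big' in \<open>auto simp: \<kappa>_def\<close>)
        then have "ic U x (strs A) + enat c \<le> enat (32 * m + 1 + (12 * \<kappa> + 2) + d1) + enat c"
          by (rule add_right_mono)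
        also have "\<dots> < enat k0" using m(2) big by (simp add: \<kappa>_def)
        finally show ?thesis .
      next
        case True
        then obtain Q0 where Q0: "?p * 2 ^ (8 * \<kappa>) \<le> cnt (20 * \<kappa>) Q0" "event (16 * \<kappa>) Q0" by blast
        \<comment> \<open>The last event of weight below \<open>16 * \<kappa>\<close>; it is not
          before \<open>Q0\<close>, so the rounded count is reached at \<open>Q\<close> too.\<close>
        define Q where "Q = Max {s. event (16 * \<kappa>) s}"
        have Q: "event (16 * \<kappa>) Q" using Max_in[OF finite_event, of "16 * \<kappa>"] Q0(2) unfolding Q_def by blast
        have Qmax: "s \<le> Q" if "event (16 * \<kappa>) s" for s
          using Max_ge[OF finite_event, of s "16 * \<kappa>"] that unfolding Q_def by simp
        show ?thesis
        proof (cases "nat_of_str x \<le> Q")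
          case True
          have "ic U x (strs A) \<le> enat (32 * m + 1 + (\<kappa> + 2) + d1)"
            by (intro d1[OF \<kappa>(1), where k = \<kappa> and p = "total \<kappa>" and e = 0])
              (use quiet total_less[of \<kappa>] big' True Q in \<open>auto simp: \<kappa>_def\<close>)
          then have "ic U x (strs A) + enat c \<le> enat (32 * m + 1 + (\<kappa> + 2) + d1) + enat c"
            by (rule add_right_mono)
          also have "\<dots> < enat k0" using m(2) big by (simp add: \<kappa>_def)
          finally show ?thesis .
        next
          case False
          have "ic U x (strs A) \<le> enat (11 * \<kappa> + 3 + d2)"
          proof (rule d2[OF \<kappa>(1) e0 hit Q])
            show "Q < nat_of_str x" using False by simp
            show "\<not> event (16 * \<kappa>) s" if "Q < s" for s using Qmax[of s] that by auto
            show "2 ^ (8 * \<kappa>) * ?p \<le> cnt (20 * \<kappa>) Q"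
              using Q0 cnt_mono[OF Qmax[OF Q0(2)], of "20 * \<kappa>"] by (simp add: mult.commute)
          qed
          then have "ic U x (strs A) + enat c \<le> enat (11 * \<kappa> + 3 + d2) + enat c"
            by (rule add_right_mono)
          also have "\<dots> < enat k0" using m(2) big by (simp add: \<kappa>_def)
          finally show ?thesis .
        qed
      qed
    qed
  qed
qed

end

section \<open>Finiteness of the hard instances\<close>

theorem theorem4p7:
  fixes U :: mapping
  assumes "optimal U"
  shows "(\<exists>A. effectively_simple A \<and> \<not> has_hard_instances U (strs A)) \<and>
         (\<exists>A. T_complete A \<and> \<not> has_hard_instances U (strs A))"
proof -
  obtain p where p: "\<forall>q z. eval {} p (prod_encode (nat_of_str q, nat_of_str z)) =
      map_option nat_of_out (U (q, z))"
    using assms unfolding optimal_def partial_recursive_mapping_def partial_recursive_def by blast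
  let ?A = "E.A (encode p)"
  have "finite {x. ic U x (strs ?A) \<ge> C U x - enat c}" for c
  proof -
    obtain K where K: "\<forall>x t k. hits (encode p) t = nat_of_str x \<longrightarrow> weight (encode p) t = Suc k \<longrightarrow>
        K \<le> k \<longrightarrow> ic U x (strs ?A) + enat c < enat k"
      using E.ic_below_weight[OF assms, where u = "encode p" and c = c] by (rule exE)
    have "\<exists>q. length q \<le> K \<and> U (q, []) = Some (Str x)" if x: "ic U x (strs ?A) \<ge> C U x - enat c" for x
    proof -
      obtain k where k: "C U x = enat k" using C_finite[OF assms, of x] by auto
      obtain t where t: "hits (encode p) t = nat_of_str x" "weight (encode p) t = Suc k"
        using ex_hit[OF p k] by blast
      have "\<not> K \<le> k"
      proof
        assume "K \<le> k"
        then have "ic U x (strs ?A) + enat c < enat k" using K t by blast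
        then show False using x k by (cases "ic U x (strs ?A)") auto
      qed
      then show ?thesis using C_attained[OF k] by (metis nat_le_linear)
    qed
    \<comment> \<open>Every hard instance has a description of length at most \<open>K\<close>, and
      there are finitely many of those; the default \<open>[]\<close> covers programs that describe
      nothing.\<close>
    then have "{x. ic U x (strs ?A) \<ge> C U x - enat c} \<subseteq>
        (\<lambda>q. case U (q, []) of Some (Str x) \<Rightarrow> x | _ \<Rightarrow> []) ` {q. set q \<subseteq> UNIV \<and> length q \<le> K}"
      by (force simp: image_iff)
    then show ?thesis
      using finite_lists_length_le[of "UNIV :: bool set" K] by (auto intro: finite_surj)
  qed
  then have "\<not> has_hard_instances U (strs ?A)" unfolding has_hard_instances_def by blast
  then show ?thesis using effectively_simple_A T_complete_A by blast
qed

end
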